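(* Let $F=\{\mathbf{p}_0,\ldots,\mathbf{p}_n\}\subset\mathbb{R}^d$ be a finite set of points not contained in any $(d-1)$-dimensional affine subspace of $\mathbb{R}^d$. Then there exists $\delta_{uni}=\delta_{uni}(F)>0$ such that for every $\lambda\in(1-\delta_{uni},1)$, the homogeneous IFS $\Phi=\{S_i\}_{i=0}^n$ with $S_i(\mathbf{x})=\lambda\mathbf{x}+(1-\lambda)\mathbf{p}_i$ satisfies $X_{uni}=\mathrm{int}(X)$.
   Context: Write $\mathcal{D}=\{0,\ldots,n\}$ and $\mathcal{D}^*=\bigcup_{j\ge0}\mathcal{D}^j$ (finite words). $X\subset\mathbb{R}^d$ denotes the unique non-empty compact set with $X=\bigcup_{i\in\mathcal{D}}S_i(X)$, and $\mathrm{int}(X)$ is its interior in $\mathbb{R}^d$. The coding map $\pi:\mathcal{D}^{\mathbb{N}}\to X$ is $\pi(\mathbf{a})=\lim_{j\to\infty}(S_{a_1}\circ\cdots\circ S_{a_j})(\mathbf{0})$; $\mathbf{a}$ is a coding of $\mathbf{x}$ if $\pi(\mathbf{a})=\mathbf{x}$. A sequence $\mathbf{a}\in\mathcal{D}^{\mathbb{N}}$ is universal if every finite word in $\mathcal{D}^*$ appears in $\mathbf{a}$ as a block of consecutive digits. $X_{uni}$ is the set of $\mathbf{x}\in X$ having at least one universal coding. *)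

theory Defs
  imports "HOL-Analysis.Analysis"
begin

definition hmap :: "real \<Rightarrow> (nat \<Rightarrow> 'a::euclidean_space) \<Rightarrow> nat \<Rightarrow> 'a \<Rightarrow> 'a" where
  "hmap lam p i x = lam *\<^sub>R x + (1 - lam) *\<^sub>R p i"

fun word_map :: "real \<Rightarrow> (nat \<Rightarrow> 'a::euclidean_space) \<Rightarrow> (nat \<Rightarrow> nat) \<Rightarrow> nat \<Rightarrow> 'a \<Rightarrow> 'a" where
  "word_map lam p a 0 = id"
| "word_map lam p a (Suc j) = word_map lam p a j \<circ> hmap lam p (a j)"

definition coding :: "real \<Rightarrow> (nat \<Rightarrow> 'a::euclidean_space) \<Rightarrow> (nat \<Rightarrow> nat) \<Rightarrow> 'a" where
  "coding lam p a = lim (\<lambda>j. word_map lam p a j 0)"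

definition attractor :: "real \<Rightarrow> (nat \<Rightarrow> 'a::euclidean_space) \<Rightarrow> nat \<Rightarrow> 'a set" where
  "attractor lam p n = (THE X. X \<noteq> {} \<and> compact X \<and> X = (\<Union>i\<in>{..n}. hmap lam p i ` X))"

definition universal :: "nat \<Rightarrow> (nat \<Rightarrow> nat) \<Rightarrow> bool" where
  "universal n a \<longleftrightarrow> (\<forall>w::nat list. set w \<subseteq> {..n} \<longrightarrow>
      (\<exists>k. \<forall>i<length w. a (k + i) = w ! i))"

definition X_uni :: "real \<Rightarrow> (nat \<Rightarrow> 'a::euclidean_space) \<Rightarrow> nat \<Rightarrow> 'a set" where
  "X_uni lam p n = {x \<in> attractor lam p n. \<exists>a. (\<forall>k. a k \<le> n) \<and> universal n a \<and> coding lam p a = x}"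

end

theory Submission
  imports Defs "HOL-Computational_Algebra.Computational_Algebra"
begin

text \<open>
  For \<open>lam\<close> close to 1 the attractor is the convex hull \<open>H\<close> of the points \<open>p i\<close>. A point on the boundary
  of \<open>H\<close> lies on a supporting hyperplane, so some digit never occurs in any of its codings.
  For an interior point it suffices that the expanding orbits are dense: with \<open>q = 1 / lam\<close>, the points
  \<open>q^m x - (q - 1) \<Sum>j<m. q^j p (d j)\<close> come arbitrarily close to every target, so that any prescribed word can
  be appended after finitely many digits without leaving the interior.

  Density rests on an arithmetic fact about every base \<open>q\<close> in \<open>(1, 1.01)\<close>: the sums \<open>\<Sum> e\<^sub>k q^k\<close> with
  \<open>e\<^sub>k \<in> {-1, 0, 1}\<close> take arbitrarily small nonzero values. Otherwise these values are separated; by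
  pigeonhole \<open>q\<close> is an algebraic integer, and each conjugate map is quasi-additive on \<open>{0, 1}\<close>-sums, hence
  within bounded distance of a linear map, which forces all other conjugates into the open unit disc. So \<open>q\<close>
  would be a Pisot number. If \<open>U\<close> is its minimal polynomial and \<open>U\<^sup>*\<close> the reciprocal polynomial, the
  power series \<open>U / U\<^sup>* = \<Sum> a\<^sub>n X^n\<close> has integer coefficients, and since \<open>(1 - q X) U / U\<^sup>*\<close> is \<open>X - q\<close> times a
  Blaschke product, \<open>\<Sum> (a\<^sub>n - q a\<^sub>n\<^sub>-\<^sub>1)\<^sup>2 \<le> 1 + q\<^sup>2\<close>. For \<open>q\<close> near 1 this is impossible.
\<close>

section \<open>No Pisot numbers near 1\<close>

text \<open>The difference of the two sides is exactly \<open>1 - (cmod \<alpha>)\<^sup>2\<close>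
  times the squared modulus of the last coefficient of \<open>h\<close>: coefficientwise it is a
  difference of consecutive terms, and it telescopes. This is the finite form of the fact that a
  Blaschke factor has modulus 1 on the unit circle, so no convergence question arises.\<close>

lemma blaschke_factor_energy_le:
  fixes h :: "complex fps"
  assumes "cmod \<alpha> \<le> 1"
  shows "(\<Sum>n\<le>N. (cmod (fps_nth ((fps_X - fps_const (cnj \<alpha>)) * h) n))\<^sup>2)
       \<le> (\<Sum>n\<le>N. (cmod (fps_nth ((1 - fps_const \<alpha> * fps_X) * h) n))\<^sup>2)"
proof -
  have L: "fps_nth ((fps_X - fps_const (cnj \<alpha>)) * h) n
      = (if n = 0 then 0 else fps_nth h (n - 1)) - cnj \<alpha> * fps_nth h n" for n
    by (simp add: algebra_simps)
  have R: "fps_nth ((1 - fps_const \<alpha> * fps_X) * h) n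
      = fps_nth h n - \<alpha> * (if n = 0 then 0 else fps_nth h (n - 1))" for n
    by (simp add: algebra_simps)
  have id: "(cmod (b - \<alpha> * a))\<^sup>2 - (cmod (a - cnj \<alpha> * b))\<^sup>2
      = (1 - (cmod \<alpha>)\<^sup>2) * ((cmod b)\<^sup>2 - (cmod a)\<^sup>2)" for a b
    unfolding cmod_power2 by (simp add: algebra_simps power2_eq_square)
  have "(\<Sum>n\<le>N. (cmod (fps_nth ((1 - fps_const \<alpha> * fps_X) * h) n))\<^sup>2)
      - (\<Sum>n\<le>N. (cmod (fps_nth ((fps_X - fps_const (cnj \<alpha>)) * h) n))\<^sup>2)
      = (1 - (cmod \<alpha>)\<^sup>2) * (cmod (fps_nth h N))\<^sup>2"
  proof (induction N)
    case 0
    show ?case using id[of "fps_nth h 0" 0] unfolding L R by simp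
  next
    case (Suc N)
    show ?case using Suc id[of "fps_nth h (Suc N)" "fps_nth h N"]
      unfolding L R by (simp add: algebra_simps)
  qed
  moreover have "\<dots> \<ge> 0"
    using assms by (intro mult_nonneg_nonneg) (auto simp: power_le_one)
  ultimately show ?thesis by linarith
qed

text \<open>Factors are exchanged one at a time; since \<open>h\<close> is arbitrary in the
  induction, the remaining factors are absorbed into it.\<close>

lemma blaschke_product_energy_le:
  fixes h :: "complex fps"
  assumes "\<forall>\<alpha>\<in>set as. cmod \<alpha> \<le> 1"
  shows "(\<Sum>n\<le>N. (cmod (fps_nth ((\<Prod>\<alpha>\<leftarrow>as. fps_X - fps_const (cnj \<alpha>)) * h) n))\<^sup>2)
       \<le> (\<Sum>n\<le>N. (cmod (fps_nth ((\<Prod>\<alpha>\<leftarrow>as. 1 - fps_const \<alpha> * fps_X) * h) n))\<^sup>2)"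
  using assms
proof (induction as arbitrary: h)
  case Nil
  then show ?case by simp
next
  case (Cons \<alpha> as)
  let ?P = "\<Prod>\<alpha>\<leftarrow>as. fps_X - fps_const (cnj \<alpha>)" and ?Q = "\<Prod>\<alpha>\<leftarrow>as. 1 - fps_const \<alpha> * fps_X"
  have "(\<Sum>n\<le>N. (cmod (fps_nth (?P * ((fps_X - fps_const (cnj \<alpha>)) * h)) n))\<^sup>2)
      \<le> (\<Sum>n\<le>N. (cmod (fps_nth (?Q * ((fps_X - fps_const (cnj \<alpha>)) * h)) n))\<^sup>2)"
    using Cons by simp
  also have "\<dots> = (\<Sum>n\<le>N. (cmod (fps_nth ((fps_X - fps_const (cnj \<alpha>)) * (?Q * h)) n))\<^sup>2)"
    by (simp only: mult_ac)
  also have "\<dots> \<le> (\<Sum>n\<le>N. (cmod (fps_nth ((1 - fps_const \<alpha> * fps_X) * (?Q * h)) n))\<^sup>2)"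
    using Cons by (intro blaschke_factor_energy_le) simp
  finally show ?case by (simp add: mult_ac)
qed

text \<open>While \<open>\<bar>A n\<bar> \<le> 4\<close>, every change of value costs at least 0.9, so a total cost of 3 keeps the sequence
  below 4 and eventually constant; a nonzero constant would cost \<open>((q - 1) A n)\<^sup>2\<close> at each step.\<close>

lemma integer_sequence_eventually_zero:
  fixes A :: "nat \<Rightarrow> int" and q :: real
  assumes q: "1 < q" "q < 1 + 1/100" and A0: "A 0 = 0"
    and cost: "\<And>N. (\<Sum>n<N. (real_of_int (A (Suc n)) - q * A n)\<^sup>2) \<le> 3"
  shows "\<exists>N. \<forall>n\<ge>N. A n = 0"
proof -
  \<comment> \<open>\<open>D\<close> is the total variation of \<open>A\<close>. It dominates
    \<open>\<bar>A N\<bar>\<close> because \<open>A 0 = 0\<close>, so a bound on \<open>D\<close> up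
    to \<open>N\<close> yields the smallness of \<open>A\<close> that is needed to bound
    \<open>D\<close> one step further.\<close>
  define D where "D N = (\<Sum>n<N. \<bar>A (Suc n) - A n\<bar>)" for N
  have AD: "\<bar>A N\<bar> \<le> D N" for N
  proof (induction N)
    case (Suc N)
    have "\<bar>A (Suc N)\<bar> \<le> \<bar>A (Suc N) - A N\<bar> + \<bar>A N\<bar>" by simp
    with Suc show ?case by (simp add: D_def)
  qed (simp add: A0 D_def)
  have Dmono: "D m \<le> D n" if "m \<le> n" for m n
    unfolding D_def using that by (intro sum_mono2) auto
  have D4: "D N \<le> 4" for N
  proof (induction N)
    case 0 show ?case by (simp add: D_def)
  next
    case (Suc N)
    have "0.9 * real_of_int \<bar>A (Suc n) - A n\<bar> \<le> (real_of_int (A (Suc n)) - q * A n)\<^sup>2"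
      if "n < Suc N" for n
    proof (cases "A (Suc n) = A n")
      case False
      define x where "x = real_of_int (A (Suc n) - A n)"
      have "\<bar>A n\<bar> \<le> 4" using AD[of n] Dmono[of n N] Suc that by simp
      then have "\<bar>real_of_int (A n)\<bar> \<le> 4" by linarith
      then have small: "\<bar>(q - 1) * real_of_int (A n)\<bar> \<le> 0.04"
        using q mult_mono[of "q - 1" "0.01" "\<bar>real_of_int (A n)\<bar>" 4] by (simp add: abs_mult)
      have x1: "\<bar>x\<bar> \<ge> 1" using False unfolding x_def by linarith
      have "\<bar>x\<bar> - 0.04 \<le> \<bar>x - (q - 1) * real_of_int (A n)\<bar>" using small by linarith
      then have s1: "(\<bar>x\<bar> - 0.04)\<^sup>2 \<le> (x - (q - 1) * real_of_int (A n))\<^sup>2"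
        using x1 power_mono[of "\<bar>x\<bar> - 0.04" "\<bar>x - (q - 1) * real_of_int (A n)\<bar>" 2] by simp
      \<comment> \<open>As \<open>\<bar>x\<bar> \<ge> 1\<close>, the square is at least
        \<open>\<bar>x\<bar> - 0.08 * \<bar>x\<bar>\<close>.\<close>
      have s2: "0.9 * \<bar>x\<bar> \<le> (\<bar>x\<bar> - 0.04)\<^sup>2"
      proof -
        have "y \<le> y * y" if "1 \<le> y" for y :: real using mult_right_mono[of 1 y y] that by simp
        from this[OF x1] show ?thesis unfolding power2_eq_square left_diff_distrib right_diff_distrib
          by linarith
      qed
      have s3: "x - (q - 1) * real_of_int (A n) = real_of_int (A (Suc n)) - q * A n"
        by (simp add: x_def algebra_simps)
      have "0.9 * \<bar>x\<bar> \<le> (real_of_int (A (Suc n)) - q * A n)\<^sup>2"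
        using s1 s2 unfolding s3 by linarith
      then show ?thesis by (simp add: x_def)
    qed simp
    then have "(\<Sum>n<Suc N. 0.9 * real_of_int \<bar>A (Suc n) - A n\<bar>) \<le> 3"
      using cost[of "Suc N"] sum_mono[of "{..<Suc N}" "\<lambda>n. 0.9 * real_of_int \<bar>A (Suc n) - A n\<bar>"
          "\<lambda>n. (real_of_int (A (Suc n)) - q * A n)\<^sup>2"]
      by (meson lessThan_iff order_trans)
    then have "0.9 * real_of_int (D (Suc N)) \<le> 3"
      unfolding D_def by (simp add: sum_distrib_left del: sum.lessThan_Suc)
    \<comment> \<open>The quotient 3 / 0.9 is below 4, which closes the induction.\<close>
    then have "real_of_int (D (Suc N)) \<le> 4" by simp
    then show ?case by linarith
  qed
  \<comment> \<open>A bounded nondecreasing integer sequence attains its maximum; from that index on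
    the variation stops growing, so \<open>A\<close> is constant.\<close>
  obtain M where M: "\<And>n. D n \<le> D M"
  proof -
    have "finite (range D)"
      by (rule finite_subset[of _ "{0..4}"]) (use D4 in \<open>auto simp: D_def sum_nonneg\<close>)
    then have "Max (range D) \<in> range D" by (intro Max_in) auto
    then obtain M where "D M = Max (range D)" by auto
    with \<open>finite (range D)\<close> show ?thesis by (intro that[of M]) auto
  qed
  have const: "A n = A M" if "n \<ge> M" for n
    using that
  proof (induction rule: dec_induct)
    case (step n)
    have "D n = D M" "D (Suc n) \<le> D n" using M[of n] M[of "Suc n"] Dmono[of M n] step by auto
    then have "\<bar>A (Suc n) - A n\<bar> \<le> 0" by (simp add: D_def)
    then show ?case using step by simp
  qed simp
  have "A M = 0"
  proof (rule ccontr)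
    assume nz: "A M \<noteq> 0"
    define c where "c = ((q - 1) * real_of_int (A M))\<^sup>2"
    have c: "c > 0" using nz q by (simp add: c_def)
    have lb: "real k * c \<le> 3" for k
    proof -
      have "real k * c = (\<Sum>n\<in>{M..<M+k}. (real_of_int (A (Suc n)) - q * A n)\<^sup>2)"
      proof -
        have "(real_of_int (A (Suc n)) - q * A n)\<^sup>2 = c" if "n \<in> {M..<M+k}" for n
        proof -
          have "real_of_int (A (Suc n)) - q * A n = - ((q - 1) * A M)"
            using const[of n] const[of "Suc n"] that by (simp add: algebra_simps)
          then show ?thesis by (simp only: c_def power2_minus)
        qed
        then show ?thesis by simp
      qed
      also have "\<dots> \<le> (\<Sum>n<M+k. (real_of_int (A (Suc n)) - q * A n)\<^sup>2)"
        by (intro sum_mono2) auto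
      finally show ?thesis using cost[of "M+k"] by simp
    qed
    obtain k where "3 < real k * c" using c ex_less_of_nat_mult by blast
    with lb[of k] show False by simp
  qed
  then show ?thesis using const by metis
qed

section \<open>Images of integer polynomials in other rings\<close>

lemma map_poly_of_int_add:
  "map_poly of_int (p + r) = map_poly of_int p + (map_poly of_int r :: 'a::ring_1 poly)"
  by (intro poly_eqI) (simp add: coeff_map_poly)

lemma map_poly_of_int_diff:
  "map_poly of_int (p - r) = map_poly of_int p - (map_poly of_int r :: 'a::ring_1 poly)"
  by (intro poly_eqI) (simp add: coeff_map_poly)

lemma map_poly_of_int_mult:
  "map_poly of_int (p * r) = map_poly of_int p * (map_poly of_int r :: 'a::comm_ring_1 poly)"
  by (intro poly_eqI) (simp add: coeff_map_poly coeff_mult)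

lemma map_poly_of_int_smult:
  "map_poly of_int (smult c p) = smult (of_int c) (map_poly of_int p :: 'a::comm_ring_1 poly)"
  by (intro poly_eqI) (simp add: coeff_map_poly)

lemma map_poly_of_int_pderiv:
  "map_poly of_int (pderiv p) = pderiv (map_poly of_int p :: 'a::idom poly)"
  by (intro poly_eqI) (simp add: coeff_map_poly coeff_pderiv)

lemma poly_map_of_int_of_real:
  "poly (map_poly of_int p) (of_real x :: 'a::{comm_ring_1,real_algebra_1}) = of_real (poly (map_poly of_int p) x)"
  by (induction p) (simp_all add: map_poly_pCons)

lemma poly_map_of_int_of_int:
  "poly (map_poly of_int p) (of_int k :: 'a::comm_ring_1) = of_int (poly p k)"
  by (induction p) (simp_all add: map_poly_pCons)

text \<open>Since \<open>U\<close> is monic, its reciprocal polynomial has constant term 1 and the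
  quotient series has integer coefficients. The energy bound forces this series to be a polynomial,
  so the reciprocal polynomial divides \<open>U\<close>. Then \<open>1 / q\<close> is the only
  possible other conjugate, and evaluation at 1 gives an integer strictly between -1 and 0.\<close>

lemma no_pisot_near_one:
  fixes U :: "int poly" and q :: real
  assumes q: "1 < q" "q < 1 + 1/100"
    and monic: "lead_coeff U = 1" and U0: "coeff U 0 \<noteq> 0"
    and root: "poly (map_poly of_int U) q = 0"
    and simple: "poly (map_poly of_int (pderiv U)) q \<noteq> 0"
    and others: "\<And>\<alpha>::complex. poly (map_poly of_int U) \<alpha> = 0 \<Longrightarrow> \<alpha> \<noteq> of_real q \<Longrightarrow> cmod \<alpha> < 1"
  shows False
proof -
  define UC :: "complex poly" where "UC = map_poly of_int U"
  have cUC: "coeff UC n = of_int (coeff U n)" for n by (simp add: UC_def coeff_map_poly)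
  have dUC: "degree UC = degree U" unfolding UC_def by (rule degree_map_poly) simp
  have lUC: "lead_coeff UC = 1" using monic by (simp add: cUC dUC)
  have UC0: "UC \<noteq> 0" using lUC by auto
  have rootC: "poly UC (of_real q) = 0"
    using root by (simp add: UC_def poly_map_of_int_of_real)
  then obtain V where V: "UC = [:- of_real q, 1:] * V"
    unfolding poly_eq_0_iff_dvd by (elim dvdE)
  have "poly (pderiv UC) (of_real q) = poly V (of_real q)"
    unfolding V pderiv_mult by (simp add: pderiv_pCons)
  moreover have "poly (pderiv UC) (of_real q) \<noteq> 0"
    using simple by (simp add: UC_def poly_map_of_int_of_real flip: map_poly_of_int_pderiv)
  ultimately have Vq: "poly V (of_real q) \<noteq> 0" by simp
  have lV: "lead_coeff V = 1" using lUC unfolding V lead_coeff_mult by simp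
  obtain as where as: "mset as = proots V" using ex_mset by blast
  have Vprod: "V = (\<Prod>\<alpha>\<leftarrow>as. [:- \<alpha>, 1:])"
    using complex_poly_decompose_multiset[of V] by (simp add: lV flip: as prod_mset_prod_list)
  have V0: "V \<noteq> 0" using lV by auto
  have as_root: "poly V \<alpha> = 0" if "\<alpha> \<in> set as" for \<alpha>
    using that V0 set_count_proots[of V] by (auto simp flip: as)
  have as_UC: "poly UC \<alpha> = 0" if "\<alpha> \<in> set as" for \<alpha>
    using as_root[OF that] by (simp add: V)
  have as_lt: "cmod \<alpha> < 1" if "\<alpha> \<in> set as" for \<alpha>
    using as_root[OF that] as_UC[OF that] Vq others[of \<alpha>] unfolding UC_def by metis
  define P where "P = (\<Prod>\<alpha>\<leftarrow>as. fps_X - fps_const (cnj \<alpha>))"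
  define B where "B = (\<Prod>\<alpha>\<leftarrow>as. 1 - fps_const \<alpha> * fps_X)"
  define F where "F = fps_of_poly UC"
  define R where "R = fps_of_poly (reflect_poly UC)"
  \<comment> \<open>The numerators of the Blaschke factors contain conjugated roots; the
    factorisation survives conjugation because \<open>UC\<close> has real coefficients and
    \<open>q\<close> is real.\<close>
  have UCcnj: "UC = [:- of_real q, 1:] * (\<Prod>\<alpha>\<leftarrow>as. [:- cnj \<alpha>, 1:])"
  proof -
    have "map_poly cnj UC = UC" by (intro poly_eqI) (simp add: coeff_map_poly cUC)
    then have "poly UC z = cnj (poly UC (cnj z))" for z
      by (metis poly_map_poly_cnj)
    moreover have "cnj (poly (\<Prod>\<alpha>\<leftarrow>xs. [:- \<alpha>, 1:]) (cnj z)) = poly (\<Prod>\<alpha>\<leftarrow>xs. [:- cnj \<alpha>, 1:]) z" for z xs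
      by (induction xs) (simp_all add: algebra_simps)
    ultimately have "poly UC z = poly ([:- of_real q, 1:] * (\<Prod>\<alpha>\<leftarrow>as. [:- cnj \<alpha>, 1:])) z" for z
      unfolding V Vprod by simp
    then show ?thesis by (simp add: poly_eq_poly_eq_iff[symmetric] fun_eq_iff)
  qed
  have lin: "fps_of_poly [:- c, 1:] = fps_X - fps_const c"
    and lin': "fps_of_poly [:1, - c:] = 1 - fps_const c * fps_X" for c :: complex
    by (simp_all add: fps_of_poly_linear fps_of_poly_linear' flip: fps_const_neg)
  have F: "F = (fps_X - fps_const (of_real q)) * P"
  proof -
    have "fps_of_poly (\<Prod>\<alpha>\<leftarrow>as. [:- cnj \<alpha>, 1:]) = P"
      unfolding P_def fps_of_poly_prod_list by (simp add: o_def lin)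
    then show ?thesis
      unfolding F_def by (subst UCcnj) (simp only: fps_of_poly_mult lin)
  qed
  have R: "R = (1 - fps_const (of_real q) * fps_X) * B"
  proof -
    have refl: "reflect_poly [:- c, 1:] = [:1, - c:]" for c :: complex
      by (cases "c = 0") (simp_all add: reflect_poly_def)
    have "fps_of_poly (reflect_poly V) = B"
      unfolding B_def Vprod reflect_poly_prod_list fps_of_poly_prod_list
      by (simp add: o_def refl lin')
    then show ?thesis
      unfolding R_def V reflect_poly_mult refl fps_of_poly_mult lin' by simp
  qed
  have R0: "fps_nth R 0 = 1" unfolding R_def using lUC by simp
  have "fps_nth R 0 = fps_nth B 0" unfolding R by simp
  then have B0: "fps_nth B 0 = 1" using R0 by simp
  define a where "a = F * inverse R"
  have Ra: "R * a = F"
    unfolding a_def using inverse_mult_eq_1'[of R] R0 by (simp add: mult.left_commute)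
  define h where "h = (fps_X - fps_const (of_real q)) * inverse B"
  have Bh: "B * h = fps_X - fps_const (of_real q)"
    unfolding h_def using inverse_mult_eq_1'[of B] B0 by (simp add: mult.left_commute)
  \<comment> \<open>The factor \<open>1 - q X\<close> removes the only zero of the denominator
    \<open>R\<close> inside the unit disc. What remains is \<open>P * h\<close>, and the Blaschke
    estimate compares it with \<open>B * h\<close>, whose only nonzero coefficients are
    \<open>-q\<close> and 1.\<close>
  define g where "g = (1 - fps_const (of_real q) * fps_X) * a"
  have "B * g = B * (P * h)"
  proof -
    have "B * g = R * a" by (simp add: g_def R mult_ac)
    also have "\<dots> = P * (B * h)" by (simp add: Ra F Bh mult_ac)
    finally show ?thesis by (simp add: mult_ac)
  qed
  moreover have "B \<noteq> 0" using B0 by auto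
  ultimately have g: "g = P * h" by simp
  have energy: "(\<Sum>n\<le>N. (cmod (fps_nth g n))\<^sup>2) \<le> 1 + q\<^sup>2" for N
  proof -
    have "(\<Sum>n\<le>N. (cmod (fps_nth g n))\<^sup>2) \<le> (\<Sum>n\<le>N. (cmod (fps_nth (B * h) n))\<^sup>2)"
      unfolding g P_def B_def using as_lt by (intro blaschke_product_energy_le) (auto intro: less_imp_le)
    also have "\<dots> = (\<Sum>n\<le>N. (if n = 1 then 1 else 0) + (if n = 0 then q\<^sup>2 else 0))"
      unfolding Bh by (intro sum.cong) auto
    also have "\<dots> \<le> 1 + q\<^sup>2" by (simp add: sum.distrib)
    finally show ?thesis .
  qed
  have a_int: "fps_nth a n \<in> \<int>" for n
  proof (induction n rule: less_induct)
    case (less n)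
    have "fps_nth F n = (\<Sum>i=0..n. fps_nth R i * fps_nth a (n - i))"
      by (simp add: fps_mult_nth flip: Ra)
    also have "\<dots> = fps_nth a n + (\<Sum>i=Suc 0..n. fps_nth R i * fps_nth a (n - i))"
      by (subst sum.atLeast_Suc_atMost) (simp_all add: R0)
    finally have "fps_nth a n = fps_nth F n - (\<Sum>i=Suc 0..n. fps_nth R i * fps_nth a (n - i))"
      by simp
    moreover have "fps_nth R i \<in> \<int>" for i
      by (simp add: R_def coeff_reflect_poly cUC)
    moreover have "fps_nth F n \<in> \<int>" by (simp add: F_def cUC)
    ultimately show ?case
      using less by (auto intro!: Ints_diff Ints_sum Ints_mult)
  qed
  then have "\<forall>n. \<exists>k. fps_nth a n = of_int k" by (meson Ints_cases)
  then obtain z where z: "\<And>n. fps_nth a n = of_int (z n)"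
    using choice[of "\<lambda>n k. fps_nth a n = of_int k"] by blast
  \<comment> \<open>The shift with \<open>A 0 = 0\<close> gives coefficient 0 of \<open>g\<close>
    the same form \<open>A (n + 1) - q * A n\<close> as all the others.\<close>
  define A where "A n = (case n of 0 \<Rightarrow> 0 | Suc k \<Rightarrow> z k)" for n
  have gA: "fps_nth g n = of_real (real_of_int (A (Suc n)) - q * A n)" for n
    unfolding g_def by (cases n) (simp_all add: left_diff_distrib mult.assoc z A_def)
  have "\<exists>N. \<forall>n\<ge>N. A n = 0"
  proof (rule integer_sequence_eventually_zero[OF q])
    show "A 0 = 0" by (simp add: A_def)
    show "(\<Sum>n<N. (real_of_int (A (Suc n)) - q * A n)\<^sup>2) \<le> 3" for N
    proof -
      have "(\<Sum>n<N. (real_of_int (A (Suc n)) - q * A n)\<^sup>2) \<le> (\<Sum>n\<le>N. (real_of_int (A (Suc n)) - q * A n)\<^sup>2)"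
        by (intro sum_mono2) auto
      also have "\<dots> \<le> 1 + q\<^sup>2" using energy[of N] unfolding gA norm_of_real by simp
      also have "\<dots> \<le> 3" using q power_mono[of q "1 + 1/100" 2] by (simp add: power2_eq_square)
      finally show ?thesis .
    qed
  qed
  then obtain N where N: "\<And>n. n \<ge> N \<Longrightarrow> A n = 0" by auto
  have zN: "z n = 0" if "n \<ge> N" for n using N[of "Suc n"] that by (simp add: A_def)
  define p where "p = Poly (map (\<lambda>n. fps_nth a n) [0..<N])"
  have "a = fps_of_poly p"
    by (rule fps_ext) (auto simp: p_def coeff_Poly_eq nth_default_def z zN)
  then have UCp: "UC = reflect_poly UC * p"
    using Ra unfolding F_def R_def by (simp add: fps_of_poly_eq_iff flip: fps_of_poly_mult)
  \<comment> \<open>Inverses of nonzero roots of \<open>UC\<close> are roots of the reciprocal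
    polynomial, hence of \<open>UC\<close> by \<open>UCp\<close>. The inverse of a conjugate in the
    open disc lies outside it, so it must be \<open>q\<close>.\<close>
  have as_inv: "\<alpha> = of_real (1 / q)" if "\<alpha> \<in> set as" for \<alpha>
  proof -
    have nz: "\<alpha> \<noteq> 0" using as_UC[OF that] U0 by (auto simp: poly_0_coeff_0 cUC)
    then have "poly (reflect_poly UC) (inverse \<alpha>) = 0"
      using as_UC[OF that] by (simp add: poly_reflect_poly_nz)
    then have "poly UC (inverse \<alpha>) = 0" by (subst UCp) simp
    moreover have "\<not> cmod (inverse \<alpha>) < 1"
      using as_lt[OF that] nz one_less_inverse[of "cmod \<alpha>"] by (simp add: norm_inverse)
    ultimately have "inverse \<alpha> = of_real q" using others[of "inverse \<alpha>"] unfolding UC_def by blast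
    then show ?thesis by (metis inverse_eq_divide inverse_inverse_eq of_real_inverse)
  qed
  have "poly UC 1 = of_real (1 - q) * (\<Prod>\<alpha>\<leftarrow>as. 1 - \<alpha>)"
  proof -
    have "poly (\<Prod>\<alpha>\<leftarrow>xs. [:- \<alpha>, 1:]) 1 = (\<Prod>\<alpha>\<leftarrow>xs. 1 - \<alpha>)" for xs :: "complex list"
      by (induction xs) (simp_all add: algebra_simps)
    then show ?thesis unfolding V Vprod poly_mult by simp
  qed
  also have "map (\<lambda>\<alpha>. 1 - \<alpha>) as = replicate (length as) (of_real (1 - 1 / q))"
    using as_inv by (intro replicate_eqI) auto
  finally have "poly UC 1 = of_real ((1 - q) * (1 - 1 / q) ^ length as)"
    by (simp add: prod_list_replicate)
  moreover have "poly UC 1 = of_real (of_int (poly U 1))"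
    using poly_map_of_int_of_int[of U 1, where 'a=complex] by (simp add: UC_def)
  ultimately have "real_of_int (poly U 1) = (1 - q) * (1 - 1 / q) ^ length as"
    using of_real_eq_iff by metis
  moreover have "0 < (1 - 1 / q) ^ length as" "(1 - 1 / q) ^ length as \<le> 1"
    using q by (auto intro!: power_le_one)
  then have "0 < (q - 1) * (1 - 1 / q) ^ length as" "(q - 1) * (1 - 1 / q) ^ length as < 1"
    using q mult_mono[of "q - 1" "1/100" "(1 - 1 / q) ^ length as" 1] by auto
  ultimately have "- 1 < real_of_int (poly U 1)" "real_of_int (poly U 1) < 0"
    by (auto simp: algebra_simps)
  then have "- 1 < poly U 1" "poly U 1 < 0" by simp_all
  then show False by linarith
qed

section \<open>Separated bases are Pisot numbers\<close>

text \<open>Points at least \<eta> apart cannot share a cell of a grid of width \<eta>. The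
  injectivity serves the counting in \<open>monic_relation\<close>, the finiteness the bound on
  conjugates.\<close>

lemma separated_finite_Int_bounded:
  fixes X :: "real set"
  assumes "0 < \<eta>" and sep: "\<And>x y. x \<in> X \<Longrightarrow> y \<in> X \<Longrightarrow> x \<noteq> y \<Longrightarrow> \<eta> \<le> \<bar>x - y\<bar>"
  shows "inj_on (\<lambda>x. \<lfloor>x / \<eta>\<rfloor>) X" and "finite {x \<in> X. \<bar>x\<bar> \<le> C}"
proof -
  show inj: "inj_on (\<lambda>x. \<lfloor>x / \<eta>\<rfloor>) X"
  proof (rule inj_onI, rule ccontr)
    fix x y assume xy: "x \<in> X" "y \<in> X" "\<lfloor>x / \<eta>\<rfloor> = \<lfloor>y / \<eta>\<rfloor>" "x \<noteq> y"
    have "\<bar>x / \<eta> - y / \<eta>\<bar> < 1" using xy(3) by linarith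
    then have "\<bar>x - y\<bar> / \<eta> < 1"
      using assms(1) by (simp add: abs_divide flip: diff_divide_distrib)
    with sep[of x y] xy assms(1) show False by simp
  qed
  have "(\<lambda>x. \<lfloor>x / \<eta>\<rfloor>) ` {x \<in> X. \<bar>x\<bar> \<le> C} \<subseteq> {\<lfloor>- C / \<eta>\<rfloor>..\<lfloor>C / \<eta>\<rfloor>}"
  proof clarsimp
    fix x assume "\<bar>x\<bar> \<le> C"
    then have "- C \<le> x" "x \<le> C" by auto
    then have "- C / \<eta> \<le> x / \<eta>" "x / \<eta> \<le> C / \<eta>"
      using assms(1) divide_right_mono[of "- C" x \<eta>] divide_right_mono[of x C \<eta>] by auto
    then show "\<lfloor>- (C / \<eta>)\<rfloor> \<le> \<lfloor>x / \<eta>\<rfloor> \<and> \<lfloor>x / \<eta>\<rfloor> \<le> \<lfloor>C / \<eta>\<rfloor>"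
      by (auto intro!: floor_mono)
  qed
  then have "finite ((\<lambda>x. \<lfloor>x / \<eta>\<rfloor>) ` {x \<in> X. \<bar>x\<bar> \<le> C})" by (rule finite_subset) simp
  then show "finite {x \<in> X. \<bar>x\<bar> \<le> C}"
    by (rule finite_imageD) (rule inj_on_subset[OF inj], auto)
qed

text \<open>The Hyers-Ulam argument: replacing \<open>u (m * n)\<close> by \<open>m * u n\<close>
  costs at most a multiple of \<open>m * C\<close>, so the quotients \<open>u n / n\<close> are
  Cauchy, and comparison with their limit keeps the constant \<open>C\<close>.\<close>

lemma quasi_additive_near_linear:
  fixes u :: "nat \<Rightarrow> complex"
  assumes qa: "\<And>m n. cmod (u (m + n) - u m - u n) \<le> C"
  shows "\<exists>c. \<forall>n. cmod (u n - of_nat n * c) \<le> C"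
proof -
  have C0: "0 \<le> C" using order_trans[OF norm_ge_zero qa] .
  have mult: "cmod (u (Suc m * n) - of_nat (Suc m) * u n) \<le> of_nat m * C" for m n
  proof (induction m)
    case (Suc m)
    have "u (Suc (Suc m) * n) - of_nat (Suc (Suc m)) * u n
        = (u (Suc m * n + n) - u (Suc m * n) - u n) + (u (Suc m * n) - of_nat (Suc m) * u n)"
      by (simp add: algebra_simps)
    also have "cmod \<dots> \<le> C + of_nat m * C"
      by (rule order_trans[OF norm_triangle_ineq]) (intro add_mono qa Suc)
    finally show ?case by (simp add: algebra_simps)
  qed simp
  define v where "v n = u (Suc n) / of_nat (Suc n)" for n
  have est: "cmod (u (Suc m * Suc n) / of_nat (Suc m * Suc n) - v n) \<le> C / Suc n" for m n
  proof -
    have "u (Suc m * Suc n) / of_nat (Suc m * Suc n) - v n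
        = (u (Suc m * Suc n) - of_nat (Suc m) * u (Suc n)) / of_nat (Suc m * Suc n)"
      unfolding v_def of_nat_mult by (simp add: field_simps del: of_nat_Suc mult_Suc mult_Suc_right)
    also have "cmod \<dots> \<le> (of_nat m * C) / of_nat (Suc m * Suc n)"
      unfolding norm_divide norm_of_nat by (intro divide_right_mono mult) auto
    also have "\<dots> \<le> (of_nat (Suc m) * C) / of_nat (Suc m * Suc n)"
      using C0 by (intro divide_right_mono mult_right_mono) auto
    also have "\<dots> = C / Suc n" unfolding of_nat_mult by (simp del: of_nat_Suc)
    finally show ?thesis .
  qed
  have vv: "cmod (v m - v n) \<le> C / Suc m + C / Suc n" for m n
  proof -
    have "v m - v n = (u (Suc m * Suc n) / of_nat (Suc m * Suc n) - v n)
        - (u (Suc n * Suc m) / of_nat (Suc n * Suc m) - v m)"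
      by (simp add: mult.commute)
    also have "cmod \<dots> \<le> C / Suc n + C / Suc m"
      by (rule order_trans[OF norm_triangle_ineq4]) (intro add_mono est)
    finally show ?thesis by simp
  qed
  have "Cauchy v"
  proof (rule metric_CauchyI)
    fix e :: real assume e: "0 < e"
    obtain M :: nat where M: "2 * C / e < real M" using reals_Archimedean2 by blast
    have small: "C / Suc n < e / 2" if "n \<ge> M" for n
    proof -
      have "2 * C / e < real (Suc n)" using M that by simp
      then show ?thesis using e by (simp add: field_simps)
    qed
    show "\<exists>M. \<forall>m\<ge>M. \<forall>n\<ge>M. dist (v m) (v n) < e"
    proof (intro exI allI impI)
      fix m n assume "m \<ge> M" "n \<ge> M"
      then show "dist (v m) (v n) < e"
        using vv[of m n] small[of m] small[of n] unfolding dist_norm by linarith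
    qed
  qed
  then obtain c where c: "v \<longlonglongrightarrow> c" using Cauchy_convergent convergent_def by blast
  have "cmod (u n - of_nat n * c) \<le> C" for n
  proof (cases n)
    case 0
    then show ?thesis using qa[of 0 0] by simp
  next
    case (Suc k)
    have "cmod (v k - c) \<le> C / Suc k"
    proof (rule tendsto_le[of sequentially])
      show "(\<lambda>m. C / Suc m + C / Suc k) \<longlonglongrightarrow> C / Suc k"
        using tendsto_add[OF LIMSEQ_Suc[OF lim_const_over_n[of C]] tendsto_const[of "C / Suc k"]] by simp
      show "(\<lambda>m. cmod (v k - v m)) \<longlonglongrightarrow> cmod (v k - c)"
        by (intro tendsto_intros c)
      show "\<forall>\<^sub>F m in sequentially. cmod (v k - v m) \<le> C / Suc m + C / Suc k"
        using vv[of k] by (simp add: add.commute)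
    qed simp
    moreover have "u n - of_nat n * c = of_nat (Suc k) * (v k - c)"
      unfolding Suc v_def by (simp add: field_simps del: of_nat_Suc)
    then have "cmod (u n - of_nat n * c) = real (Suc k) * cmod (v k - c)"
      by (simp only: norm_mult norm_of_nat)
    ultimately show ?thesis by (simp add: pos_le_divide_eq mult.commute del: of_nat_Suc)
  qed
  then show ?thesis by blast
qed

text \<open>Splitting an initial segment by the sign of its terms bounds the sum of absolute values
  by \<open>2 * C\<close>, so the series converges absolutely.\<close>

lemma bounded_subset_sums_tendsto_0_real:
  fixes \<rho> :: "nat \<Rightarrow> real"
  assumes "\<And>A. finite A \<Longrightarrow> \<bar>\<Sum>k\<in>A. \<rho> k\<bar> \<le> C"
  shows "\<rho> \<longlonglongrightarrow> 0"
proof -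
  have "(\<Sum>k<N. \<bar>\<rho> k\<bar>) \<le> 2 * C" for N
  proof -
    let ?P = "{k\<in>{..<N}. \<rho> k \<ge> 0}" and ?M = "{k\<in>{..<N}. \<not> \<rho> k \<ge> 0}"
    have "(\<Sum>k<N. \<bar>\<rho> k\<bar>) = (\<Sum>k\<in>?P. \<bar>\<rho> k\<bar>) + (\<Sum>k\<in>?M. \<bar>\<rho> k\<bar>)"
      by (subst sum.union_disjoint[symmetric]) (auto intro!: sum.cong)
    also have "\<dots> = (\<Sum>k\<in>?P. \<rho> k) + - (\<Sum>k\<in>?M. \<rho> k)"
      unfolding sum_negf[symmetric] by (intro arg_cong2[where f="(+)"] sum.cong) auto
    also have "\<dots> \<le> C + C"
      using assms[of ?P] assms[of ?M] by (intro add_mono) auto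
    finally show ?thesis by simp
  qed
  then have "summable (\<lambda>k. \<bar>\<rho> k\<bar>)" by (intro summableI_nonneg_bounded) auto
  then show ?thesis
    using summable_LIMSEQ_zero tendsto_rabs_zero_iff by blast
qed

lemma bounded_subset_sums_tendsto_0:
  fixes \<rho> :: "nat \<Rightarrow> complex"
  assumes "\<And>A. finite A \<Longrightarrow> cmod (\<Sum>k\<in>A. \<rho> k) \<le> C"
  shows "\<rho> \<longlonglongrightarrow> 0"
proof -
  have "(\<lambda>k. Re (\<rho> k)) \<longlonglongrightarrow> 0"
  proof (rule bounded_subset_sums_tendsto_0_real)
    show "\<bar>\<Sum>k\<in>A. Re (\<rho> k)\<bar> \<le> C" if "finite A" for A
      using abs_Re_le_cmod[of "\<Sum>k\<in>A. \<rho> k"] assms[OF that] by simp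
  qed
  moreover have "(\<lambda>k. Im (\<rho> k)) \<longlonglongrightarrow> 0"
  proof (rule bounded_subset_sums_tendsto_0_real)
    show "\<bar>\<Sum>k\<in>A. Im (\<rho> k)\<bar> \<le> C" if "finite A" for A
      using abs_Im_le_cmod[of "\<Sum>k\<in>A. \<rho> k"] assms[OF that] by simp
  qed
  ultimately show ?thesis by (simp add: tendsto_complex_iff)
qed

text \<open>A polynomial of least degree vanishing at \<open>q\<close> divides every other one up to
  an integer factor, by pseudo-division. Its primitive part then has leading coefficient 1 or -1, by
  comparison of contents with the monic \<open>R\<close>. Minimality of the degree also makes the
  root \<open>q\<close> simple.\<close>

lemma minimal_integer_polynomial:
  fixes q :: real
  assumes "q \<noteq> 0" and R: "lead_coeff R = 1" "poly (map_poly of_int R) q = 0"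
  obtains U :: "int poly" where "lead_coeff U = 1" "coeff U 0 \<noteq> 0"
    "poly (map_poly of_int U) q = 0" "poly (map_poly of_int (pderiv U)) q \<noteq> 0"
    "\<And>S (\<alpha>::complex). poly (map_poly of_int S) q = 0 \<Longrightarrow> poly (map_poly of_int U) \<alpha> = 0
       \<Longrightarrow> poly (map_poly of_int S) \<alpha> = 0"
proof -
  define Z where "Z S \<longleftrightarrow> S \<noteq> 0 \<and> poly (map_poly of_int S) q = 0" for S :: "int poly"
  have "Z R" using R by (auto simp: Z_def)
  then obtain U0 where U0: "Z U0" and min: "\<And>S. Z S \<Longrightarrow> degree U0 \<le> degree S"
    using ex_has_least_nat[of Z R degree] by blast
  define U1 where "U1 = primitive_part U0"
  have U01: "U0 = smult (content U0) U1" by (simp add: U1_def)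
  have c1: "content U1 = 1" using U0 by (simp add: U1_def Z_def)
  have d1: "degree U1 = degree U0" by (simp add: U1_def)
  have Z1: "Z U1"
  proof -
    have "of_int (content U0) * poly (map_poly of_int U1) q = poly (map_poly of_int U0) q"
      by (subst (2) U01) (simp add: map_poly_of_int_smult)
    then show ?thesis using U0 by (auto simp: Z_def U1_def)
  qed
  have divides: "\<exists>a T. a \<noteq> 0 \<and> smult a S = U1 * T" if S: "poly (map_poly of_int S) q = 0" for S
  proof -
    obtain a T where aT: "a \<noteq> 0" "smult a S = U1 * T + pseudo_mod S U1"
      using pseudo_mod(1)[of U1 S] Z1 by (auto simp: Z_def)
    have "poly (map_poly of_int (smult a S)) q = poly (map_poly of_int (U1 * T + pseudo_mod S U1)) q"
      using aT by simp
    then have "poly (map_poly of_int (pseudo_mod S U1)) q = 0"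
      using S Z1 by (simp add: map_poly_of_int_smult map_poly_of_int_add map_poly_of_int_mult Z_def)
    moreover have "pseudo_mod S U1 = 0 \<or> degree (pseudo_mod S U1) < degree U1"
      using pseudo_mod(2)[of U1 S] Z1 by (auto simp: Z_def)
    ultimately have "pseudo_mod S U1 = 0"
      using min[of "pseudo_mod S U1"] d1 unfolding Z_def by linarith
    then show ?thesis using aT by auto
  qed
  obtain a T where aT: "a \<noteq> 0" "smult a R = U1 * T" using divides R by blast
  \<comment> \<open>Gauss's lemma: \<open>R\<close> and \<open>U1\<close> have content 1, so
    \<open>T\<close> has the content of \<open>a\<close>. Hence \<open>a\<close> cancels, and
    \<open>U1\<close> divides the monic \<open>R\<close> over the integers.\<close>
  have "content R dvd 1" using content_dvd_coeff[of R "degree R"] R by simp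
  then have "content R = 1" by (simp only: is_unit_content_iff)
  then have "content T = normalize a"
    using arg_cong[OF aT(2), of content] c1 by (simp add: content_mult)
  then have "[:a:] dvd T" by (simp add: const_poly_dvd_iff_dvd_content)
  then obtain T' where "T = smult a T'" by (auto elim!: dvdE)
  then have "smult a R = smult a (U1 * T')" using aT by simp
  then have "R = U1 * T'" using aT(1) by (metis smult_cancel)
  then have "lead_coeff U1 * lead_coeff T' = 1" using R(1) by (simp add: lead_coeff_mult)
  then have l1: "lead_coeff U1 * lead_coeff U1 = 1" by (auto simp: zmult_eq_1_iff)
  have l0: "lead_coeff U1 \<noteq> 0" using Z1 by (simp add: Z_def)
  define U where "U = smult (lead_coeff U1) U1"
  have lU: "lead_coeff U = 1" using l1 l0 by (simp add: U_def)
  have dU: "degree U = degree U0" using l0 d1 by (simp add: U_def)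
  have evU: "poly (map_poly of_int U) z = of_int (lead_coeff U1) * poly (map_poly of_int U1) z"
    for z :: "'b::comm_ring_1"
    by (simp add: U_def map_poly_of_int_smult)
  have ZU: "poly (map_poly of_int U) q = 0" using Z1 by (simp add: evU Z_def)
  have dpos: "degree U > 0"
  proof (rule ccontr)
    assume "\<not> degree U > 0"
    then obtain c where "U = [:c:]" by (auto elim: degree_eq_zeroE)
    then show False using lU ZU by (simp add: map_poly_pCons)
  qed
  show ?thesis
  proof
    show "lead_coeff U = 1" by fact
    show "poly (map_poly of_int U) q = 0" by fact
    show "coeff U 0 \<noteq> 0"
    proof
      assume "coeff U 0 = 0"
      then obtain V where V: "U = pCons 0 V" by (metis pCons_cases coeff_pCons_0)
      then have "V \<noteq> 0" using dpos by auto
      moreover have "poly (map_poly of_int V) q = 0" using ZU assms(1) by (simp add: V map_poly_pCons)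
      ultimately have "degree U0 \<le> degree V" by (intro min) (simp add: Z_def)
      then show False using dU \<open>V \<noteq> 0\<close> by (simp add: V)
    qed
    show "poly (map_poly of_int (pderiv U)) q \<noteq> 0"
    proof
      assume "poly (map_poly of_int (pderiv U)) q = 0"
      moreover have "pderiv U \<noteq> 0" using dpos by (simp add: pderiv_eq_0_iff)
      ultimately have "degree U0 \<le> degree (pderiv U)" by (intro min) (simp add: Z_def)
      then show False using dU dpos by (simp add: degree_pderiv)
    qed
    fix S and \<alpha> :: complex
    assume S: "poly (map_poly of_int S) q = 0" and U\<alpha>: "poly (map_poly of_int U) \<alpha> = 0"
    obtain b T where bT: "b \<noteq> 0" "smult b S = U1 * T" using divides[OF S] by blast
    have "of_int b * poly (map_poly of_int S) \<alpha> = poly (map_poly of_int U1) \<alpha> * poly (map_poly of_int T) \<alpha>"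
      using arg_cong[OF bT(2), of "\<lambda>p. poly (map_poly of_int p) \<alpha>"]
      by (simp add: map_poly_of_int_smult map_poly_of_int_mult)
    moreover have "poly (map_poly of_int U1) \<alpha> = 0" using U\<alpha> l0 by (simp add: evU)
    ultimately show "poly (map_poly of_int S) \<alpha> = 0" using bT(1) by simp
  qed
qed

text \<open>A greedy expansion in the exponents congruent to \<open>r\<close> modulo
  \<open>m\<close>. As \<open>q ^ m \<le> 2\<close>, each such power is at most twice the preceding
  one, so subtracting the lower power once leaves a remainder no larger than that power.\<close>

lemma greedy_power_sum:
  fixes q t :: real
  assumes q: "1 < q" "q ^ m \<le> 2" and t: "0 \<le> t" and m: "0 < m"
  obtains S :: "int poly" where "\<And>i. coeff S i = 0 \<or> coeff S i = 1 \<and> i mod m = r mod m"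
    "\<bar>poly (map_poly of_int S) q - t\<bar> \<le> q ^ r"
proof -
  \<comment> \<open>The bound \<open>i < m * K + r\<close> keeps the exponent added in the next step
    fresh, so the coefficients stay 0 or 1.\<close>
  have *: "\<exists>S::int poly. (\<forall>i. coeff S i = 0 \<or> coeff S i = 1 \<and> i mod m = r mod m \<and> i < m * K + r)
      \<and> 0 \<le> t - poly (map_poly of_int S) q \<and> t - poly (map_poly of_int S) q \<le> q ^ r"
    if "0 \<le> t" "t \<le> q ^ (m * K + r)" for K t
    using that
  proof (induction K arbitrary: t)
    case 0
    then show ?case by (intro exI[of _ 0]) auto
  next
    case (Suc K)
    show ?case
    proof (cases "t \<le> q ^ (m * K + r)")
      case True
      with Suc.IH[OF Suc.prems(1)] show ?thesis by (fastforce simp: algebra_simps)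
    next
      case False
      have "t \<le> q ^ m * q ^ (m * K + r)" using Suc.prems by (simp add: algebra_simps power_add)
      also have "\<dots> \<le> 2 * q ^ (m * K + r)" using q by (intro mult_right_mono) auto
      finally have "t - q ^ (m * K + r) \<le> q ^ (m * K + r)" by simp
      then obtain S :: "int poly" where S: "\<And>i. coeff S i = 0 \<or> coeff S i = 1 \<and> i mod m = r mod m \<and> i < m * K + r"
        "0 \<le> t - q ^ (m * K + r) - poly (map_poly of_int S) q"
        "t - q ^ (m * K + r) - poly (map_poly of_int S) q \<le> q ^ r"
        using Suc.IH[of "t - q ^ (m * K + r)"] False by auto
      show ?thesis
      proof (intro exI[of _ "S + monom 1 (m * K + r)"] conjI allI)
        fix i
        show "coeff (S + monom 1 (m * K + r)) i = 0 \<or>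
            coeff (S + monom 1 (m * K + r)) i = 1 \<and> i mod m = r mod m \<and> i < m * Suc K + r"
          using S(1)[of i] m by (cases "i = m * K + r") auto
      qed (use S in \<open>simp_all add: map_poly_of_int_add map_poly_monom poly_monom\<close>)
    qed
  qed
  obtain K where K: "t < q ^ K" using real_arch_pow[OF q(1)] by blast
  have "K \<le> m * K + r" using m by (cases m) auto
  then have "q ^ K \<le> q ^ (m * K + r)" using q by (intro power_increasing) auto
  then have "t \<le> q ^ (m * K + r)" using K by simp
  from *[OF t this] show ?thesis by (elim exE conjE) (rule that, auto)
qed

text \<open>The situation to be refuted for \<open>q\<close> near 1. The bound
  \<open>q ^ 3 \<le> 2\<close> makes greedy expansions possible inside a single exponent class
  modulo 3.\<close>

locale separated_base =
  fixes q \<eta> :: real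
  assumes q1: "1 < q" and q3: "q ^ 3 \<le> 2" and eta: "0 < \<eta>"
    and sep: "\<And>S :: int poly. (\<And>i. coeff S i \<in> {-1, 0, 1}) \<Longrightarrow> poly (map_poly of_int S) q \<noteq> 0
      \<Longrightarrow> \<eta> \<le> \<bar>poly (map_poly of_int S) q\<bar>"
begin

lemma q2: "q < 2"
proof (rule ccontr)
  assume "\<not> q < 2"
  then have "2 ^ 3 \<le> q ^ 3" by (intro power_mono) auto
  then show False using q3 by simp
qed

text \<open>Pigeonhole: the \<open>2 ^ K\<close> subset sums of the first \<open>K\<close> powers
  lie between 0 and \<open>q ^ K / (q - 1)\<close>. With gaps at least \<eta> and
  \<open>q < 2\<close> they cannot all be distinct for large \<open>K\<close>. Two different subsets
  with the same sum give a polynomial whose leading coefficient is 1 or -1.\<close>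

lemma monic_relation: "\<exists>R :: int poly. lead_coeff R = 1 \<and> poly (map_poly of_int R) q = 0"
proof -
  define p where "p A = (\<Sum>k\<in>A. monom (1::int) k)" for A :: "nat set"
  define v where "v A = (\<Sum>k\<in>A. q ^ k)" for A :: "nat set"
  have cp: "coeff (p A) i = (if i \<in> A then 1 else 0)" if "finite A" for A i
    using that by (simp add: p_def coeff_sum)
  have map_p: "map_poly of_int (p A) = (\<Sum>k\<in>A. monom (1::real) k)" if "finite A" for A
    using that by (intro poly_eqI) (simp add: coeff_map_poly cp coeff_sum)
  have vp: "poly (map_poly of_int (p A)) q = v A" if "finite A" for A
    using that by (simp add: map_p v_def poly_sum poly_monom)
  have "\<exists>A B. finite A \<and> finite B \<and> A \<noteq> B \<and> v A = v B"
  proof (rule ccontr)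
    assume neg: "\<not> ?thesis"
    have bound: "(2 / q) ^ K \<le> 1 / ((q - 1) * \<eta>) + 1" for K
    proof -
      define M where "M = (\<Sum>k<K. q ^ k)"
      have inj: "inj_on v (Pow {..<K})"
      proof (rule inj_onI)
        fix A B assume "A \<in> Pow {..<K}" "B \<in> Pow {..<K}" "v A = v B"
        moreover from this have "finite A" "finite B" by (auto intro: finite_subset)
        ultimately show "A = B" using neg by blast
      qed
      have "\<eta> \<le> \<bar>x - y\<bar>" if xy: "x \<in> v ` Pow {..<K}" "y \<in> v ` Pow {..<K}" "x \<noteq> y" for x y
      proof -
        obtain A B where AB: "x = v A" "y = v B" "finite A" "finite B"
          using xy(1,2) finite_subset[OF _ finite_lessThan[of K]] by auto
        have "\<eta> \<le> \<bar>poly (map_poly of_int (p A - p B)) q\<bar>"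
          using AB xy(3) by (intro sep) (auto simp: cp map_poly_of_int_diff vp)
        then show ?thesis using AB by (simp add: map_poly_of_int_diff vp)
      qed
      from separated_finite_Int_bounded(1)[OF eta this]
      have "inj_on (\<lambda>x. \<lfloor>x / \<eta>\<rfloor>) (v ` Pow {..<K})" by blast
      moreover have "(\<lambda>x. \<lfloor>x / \<eta>\<rfloor>) ` v ` Pow {..<K} \<subseteq> {0..\<lfloor>M / \<eta>\<rfloor>}"
      proof clarsimp
        fix A assume "A \<subseteq> {..<K}"
        then have "0 \<le> v A" "v A \<le> M"
          using q1 unfolding v_def M_def by (auto intro!: sum_nonneg sum_mono2)
        then show "0 \<le> v A / \<eta> \<and> \<lfloor>v A / \<eta>\<rfloor> \<le> \<lfloor>M / \<eta>\<rfloor>"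
          using eta by (auto intro!: floor_mono divide_right_mono)
      qed
      ultimately have "card (v ` Pow {..<K}) \<le> card {0..\<lfloor>M / \<eta>\<rfloor>}"
        by (intro card_inj_on_le) auto
      then have "2 ^ K \<le> nat (\<lfloor>M / \<eta>\<rfloor> + 1)" by (simp add: card_image[OF inj] card_Pow)
      then have "real (2 ^ K) \<le> real (nat (\<lfloor>M / \<eta>\<rfloor> + 1))" by (simp only: of_nat_le_iff)
      moreover have "0 \<le> M" using q1 by (simp add: M_def sum_nonneg)
      then have "0 \<le> \<lfloor>M / \<eta>\<rfloor>" using eta by simp
      then have "real (nat (\<lfloor>M / \<eta>\<rfloor> + 1)) \<le> M / \<eta> + 1" by simp
      ultimately have "real (2 ^ K) \<le> M / \<eta> + 1" by (rule order_trans)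
      then have "(2::real) ^ K \<le> M / \<eta> + 1" by simp
      moreover have "M \<le> q ^ K / (q - 1)"
        using q1 by (simp add: M_def geometric_sum divide_right_mono)
      ultimately have "(2::real) ^ K \<le> q ^ K / (q - 1) / \<eta> + 1"
        using eta by (meson add_right_mono divide_right_mono less_imp_le order_trans)
      \<comment> \<open>Absorbing the summand 1 into \<open>q ^ K\<close> makes the bound a constant
        times \<open>q ^ K\<close>, which loses against \<open>2 ^ K\<close>.\<close>
      also have "\<dots> \<le> q ^ K / (q - 1) / \<eta> + q ^ K" using q1 by simp
      also have "\<dots> = (1 / ((q - 1) * \<eta>) + 1) * q ^ K" by (simp add: algebra_simps)
      finally show ?thesis using q1 by (simp add: power_divide divide_le_eq)
    qed
    have "1 < 2 / q" using q1 q2 by simp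
    then obtain K where "1 / ((q - 1) * \<eta>) + 1 < (2 / q) ^ K" using real_arch_pow by blast
    with bound[of K] show False by simp
  qed
  then obtain A B where AB: "finite A" "finite B" "A \<noteq> B" "v A = v B" by blast
  define S where "S = p A - p B"
  have S0: "S \<noteq> 0"
  proof
    assume "S = 0"
    then have "coeff (p A) i = coeff (p B) i" for i by (simp add: S_def)
    then have "i \<in> A \<longleftrightarrow> i \<in> B" for i using AB(1,2) cp by (metis zero_neq_one)
    with AB(3) show False by blast
  qed
  have "lead_coeff S = 1 \<or> lead_coeff S = -1"
    using S0 AB(1,2) leading_coeff_neq_0[OF S0] unfolding S_def coeff_diff cp[OF AB(1)] cp[OF AB(2)]
    by (auto split: if_splits)
  moreover have "poly (map_poly of_int S) q = 0"
    using AB by (simp add: S_def map_poly_of_int_diff vp)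
  ultimately show ?thesis
  proof (elim disjE)
    assume "poly (map_poly of_int S) q = 0" "lead_coeff S = -1"
    then show ?thesis
      by (intro exI[of _ "0 - S"]) (simp add: map_poly_of_int_diff del: diff_0, simp)
  qed auto
qed

text \<open>A prescribed sign at every exponent keeps the coefficients of differences in
  \<open>{-1, 0, 1}\<close>. So the values at \<open>q\<close> are separated, and finitely many of
  them are bounded by \<open>C\<close>. By \<open>conj\<close> the value at \<alpha> depends only on
  the value at \<open>q\<close>, which leaves finitely many values at \<alpha>.\<close>

lemma bounded_conjugate_of_pattern:
  fixes \<sigma> :: "nat \<Rightarrow> int" and \<alpha> :: complex
  assumes conj: "\<And>S. poly (map_poly of_int S) q = 0 \<Longrightarrow> poly (map_poly of_int S) \<alpha> = 0"
    and \<sigma>: "\<And>i. \<sigma> i \<in> {-1, 1}"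
  obtains D where "\<And>S. (\<And>i. coeff S i \<in> {0, \<sigma> i}) \<Longrightarrow> \<bar>poly (map_poly of_int S) q\<bar> \<le> C
      \<Longrightarrow> cmod (poly (map_poly of_int S) \<alpha>) \<le> D"
proof -
  define P where "P = {S. \<forall>i. coeff S i \<in> {0, \<sigma> i}}"
  define X where "X = (\<lambda>S. poly (map_poly of_int S) q) ` P"
  have "\<eta> \<le> \<bar>x - y\<bar>" if "x \<in> X" "y \<in> X" "x \<noteq> y" for x y
  proof -
    obtain S T where ST: "S \<in> P" "T \<in> P" "x = poly (map_poly of_int S) q" "y = poly (map_poly of_int T) q"
      using \<open>x \<in> X\<close> \<open>y \<in> X\<close> unfolding X_def by blast
    have "coeff (S - T) i \<in> {-1, 0, 1}" for i
      using ST(1,2) \<sigma>[of i] unfolding P_def by (auto dest!: spec[of _ i])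
    then have "\<eta> \<le> \<bar>poly (map_poly of_int (S - T)) q\<bar>"
      using ST that(3) by (intro sep) (auto simp: map_poly_of_int_diff)
    then show ?thesis using ST by (simp add: map_poly_of_int_diff)
  qed
  from separated_finite_Int_bounded(2)[OF eta this]
  have fin: "finite {x \<in> X. \<bar>x\<bar> \<le> C}" by blast
  define f where "f x = (SOME S. S \<in> P \<and> poly (map_poly of_int S) q = x)" for x
  define V where "V = (\<lambda>x. poly (map_poly of_int (f x)) \<alpha>) ` {x \<in> X. \<bar>x\<bar> \<le> C}"
  have "bounded V" unfolding V_def using fin by (intro finite_imp_bounded) auto
  then obtain D where D: "\<And>z. z \<in> V \<Longrightarrow> cmod z \<le> D" unfolding bounded_iff by blast
  show ?thesis
  proof (rule that)
    fix S assume S: "\<And>i. coeff S i \<in> {0, \<sigma> i}" "\<bar>poly (map_poly of_int S) q\<bar> \<le> C"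
    define x where "x = poly (map_poly of_int S) q"
    have SP: "S \<in> P" using S by (auto simp: P_def)
    have "poly (map_poly of_int (f x)) q = x"
      using someI[of "\<lambda>T. T \<in> P \<and> poly (map_poly of_int T) q = x" S] SP x_def
      unfolding f_def by blast
    then have "poly (map_poly of_int (S - f x)) q = 0" by (simp add: map_poly_of_int_diff x_def)
    then have "poly (map_poly of_int S) \<alpha> = poly (map_poly of_int (f x)) \<alpha>"
      using conj[of "S - f x"] by (simp add: map_poly_of_int_diff)
    moreover have "poly (map_poly of_int (f x)) \<alpha> \<in> V"
      unfolding V_def using S SP by (intro imageI) (auto simp: X_def x_def)
    ultimately show "cmod (poly (map_poly of_int S) \<alpha>) \<le> D" using D by simp
  qed
qed

text \<open>Passing from values at \<open>q\<close> to values at \<alpha> is quasi-additive, hence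
  close to multiplication by some \<open>c\<close>. Therefore
  \<open>\<alpha> ^ j - c * q ^ j\<close> tends to 0 along two exponent classes. Eliminating
  \<open>c\<close> shows that the powers of \<alpha> tend to 0 unless \<alpha> equals
  \<open>q\<close>.\<close>

lemma conjugate_norm_less_1:
  fixes \<alpha> :: complex
  assumes conj: "\<And>S. poly (map_poly of_int S) q = 0 \<Longrightarrow> poly (map_poly of_int S) \<alpha> = 0"
    and \<alpha>: "\<alpha> \<noteq> of_real q"
  shows "cmod \<alpha> < 1"
proof -
  txt \<open>Sums over the exponent classes 0, 1 and 2 modulo 3 have disjoint supports, so a combination
    \<open>x\<^sub>0 + x\<^sub>1 - x\<^sub>2\<close> has a fixed sign pattern and differences of such combinations stay in \<open>{-1, 0, 1}\<close>.\<close>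
  define \<sigma> :: "nat \<Rightarrow> int" where "\<sigma> i = (if i mod 3 = 2 then -1 else 1)" for i
  define W where "W r S \<longleftrightarrow> (\<forall>i. coeff S i = 0 \<or> coeff S i = 1 \<and> i mod 3 = r)" for r and S :: "int poly"
  define ev where "ev S = poly (map_poly of_int S) q" for S
  define ew where "ew S = poly (map_poly of_int S) \<alpha>" for S
  have ev_simps: "ev (S + T) = ev S + ev T" "ev (S - T) = ev S - ev T" for S T
    by (simp_all add: ev_def map_poly_of_int_add map_poly_of_int_diff)
  have ew_simps: "ew (S + T) = ew S + ew T" "ew (S - T) = ew S - ew T" for S T
    by (simp_all add: ew_def map_poly_of_int_add map_poly_of_int_diff)
  \<comment> \<open>The bound 12 is 4 + 4 + 4: three representatives are combined, each within
    \<open>q ^ r \<le> q\<^sup>2 \<le> 4\<close> of its integer.\<close>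
  obtain D where D: "\<And>S. (\<And>i. coeff S i \<in> {0, \<sigma> i}) \<Longrightarrow> \<bar>ev S\<bar> \<le> 12 \<Longrightarrow> cmod (ew S) \<le> D"
  proof (rule bounded_conjugate_of_pattern[OF conj, of \<sigma> 12])
    show "\<sigma> i \<in> {-1, 1}" for i by (simp add: \<sigma>_def)
  qed (auto simp: ev_def ew_def)
  have "\<exists>S. W r S \<and> \<bar>ev S - real n\<bar> \<le> 4" if "r < 3" for r n
  proof -
    obtain S where S: "\<And>i. coeff S i = 0 \<or> coeff S i = 1 \<and> i mod 3 = r mod 3"
      "\<bar>poly (map_poly of_int S) q - real n\<bar> \<le> q ^ r"
      using greedy_power_sum[OF q1 q3, of "real n" r] by auto
    have "q ^ r \<le> q ^ 2" using q1 that by (intro power_increasing) auto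
    also have "\<dots> \<le> 2 ^ 2" using q1 q2 by (intro power_mono) auto
    finally show ?thesis using S that by (intro exI[of _ S]) (simp add: W_def ev_def)
  qed
  then have "\<forall>r n. \<exists>S. r < 3 \<longrightarrow> W r S \<and> \<bar>ev S - real n\<bar> \<le> 4" by blast
  then obtain s where s: "\<And>r n. r < 3 \<Longrightarrow> W r (s r n) \<and> \<bar>ev (s r n) - real n\<bar> \<le> 4"
    by metis
  note W = s[THEN conjunct1, unfolded W_def, rule_format]
  note near = s[THEN conjunct2]
  \<comment> \<open>Class 2 carries the negative sign in \<sigma>, so its representatives can be
    compared with elements of both class 0 and class 1.\<close>
  define u where "u n = ew (s 2 n)" for n
  have cmp: "cmod (ew x - u n) \<le> D" if "W r x" "r < 2" "\<bar>ev x - real n\<bar> \<le> 4" for x r n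
  proof -
    have "cmod (ew (x - s 2 n)) \<le> D"
    proof (rule D)
      show "coeff (x - s 2 n) i \<in> {0, \<sigma> i}" for i
        using that(1)[unfolded W_def, rule_format, of i] W[of 2 n i] that(2) by (auto simp: \<sigma>_def)
      show "\<bar>ev (x - s 2 n)\<bar> \<le> 12" using that(3) near[of 2 n] by (simp add: ev_simps)
    qed
    then show ?thesis by (simp add: ew_simps u_def)
  qed
  have "cmod (u (m + n) - u m - u n) \<le> 3 * D" for m n
  proof -
    have "cmod (ew (s 0 m + s 1 n - s 2 (m + n))) \<le> D"
    proof (rule D)
      show "coeff (s 0 m + s 1 n - s 2 (m + n)) i \<in> {0, \<sigma> i}" for i
        using W[of 0 m i] W[of 1 n i] W[of 2 "m + n" i] by (auto simp: \<sigma>_def)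
      show "\<bar>ev (s 0 m + s 1 n - s 2 (m + n))\<bar> \<le> 12"
        using near[of 0 m] near[of 1 n] near[of 2 "m + n"] by (simp add: ev_simps)
    qed
    then have 1: "cmod (ew (s 0 m) + ew (s 1 n) - u (m + n)) \<le> D" by (simp add: ew_simps u_def)
    have 2: "cmod (ew (s 0 m) - u m) \<le> D" using s[of 0 m] by (intro cmp[of 0]) auto
    have 3: "cmod (ew (s 1 n) - u n) \<le> D" using s[of 1 n] by (intro cmp[of 1]) auto
    have "u (m + n) - u m - u n = (ew (s 0 m) - u m) + (ew (s 1 n) - u n)
        - (ew (s 0 m) + ew (s 1 n) - u (m + n))" by simp
    also have "cmod \<dots> \<le> D + D + D"
      by (rule order_trans[OF norm_triangle_ineq4])
         (intro add_mono 1 order_trans[OF norm_triangle_ineq] 2 3)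
    finally show ?thesis by simp
  qed
  then obtain c where c: "\<And>n. cmod (u n - of_nat n * c) \<le> 3 * D"
    using quasi_additive_near_linear[of u "3 * D"] by blast
  \<comment> \<open>A finite subset sum of these terms is the value at \<alpha> minus
    \<open>c\<close> times the value at \<open>q\<close> of one polynomial \<open>x\<close> with
    coefficients 0 and 1. Rounding the value at \<open>q\<close> down to \<open>n\<close> and
    passing through \<open>u n\<close> bounds it independently of the subset.\<close>
  have lin: "(\<lambda>k. \<alpha> ^ (3 * k + r) - c * of_real q ^ (3 * k + r)) \<longlonglongrightarrow> 0" if r: "r < 2" for r
  proof (rule bounded_subset_sums_tendsto_0)
    fix A :: "nat set" assume A: "finite A"
    define x where "x = (\<Sum>k\<in>A. monom (1::int) (3 * k + r))"
    have coeffx: "coeff x i = (if i mod 3 = r \<and> i div 3 \<in> A then 1 else 0)" for i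
    proof -
      have "coeff x i = (\<Sum>k\<in>A. if k = i div 3 then (if i mod 3 = r then 1 else 0) else 0)"
        unfolding x_def coeff_sum using r by (intro sum.cong) auto
      then show ?thesis using A by (simp add: sum.delta)
    qed
    have mapx: "map_poly of_int x = (\<Sum>k\<in>A. monom (1::'b::{comm_ring_1}) (3 * k + r))"
    proof -
      have "map_poly of_int (\<Sum>k\<in>B. monom (1::int) (3 * k + r)) = (\<Sum>k\<in>B. monom (1::'b) (3 * k + r))"
        if "finite B" for B
        using that by (induction B) (simp_all add: map_poly_of_int_add map_poly_monom)
      then show ?thesis using A by (simp add: x_def)
    qed
    have evx: "ev x = (\<Sum>k\<in>A. q ^ (3 * k + r))"
      unfolding ev_def mapx by (simp add: poly_sum poly_monom)
    have ewx: "ew x = (\<Sum>k\<in>A. \<alpha> ^ (3 * k + r))"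
      unfolding ew_def mapx by (simp add: poly_sum poly_monom)
    define n where "n = nat \<lfloor>ev x\<rfloor>"
    have "0 \<le> ev x" unfolding evx using q1 by (intro sum_nonneg) auto
    then have n: "\<bar>ev x - real n\<bar> \<le> 1" unfolding n_def by linarith
    have "cmod (ew x - u n) \<le> D"
      using n r by (intro cmp[of r]) (auto simp: W_def coeffx)
    moreover have "cmod (c * of_real (real n - ev x)) \<le> cmod c"
      using n by (simp add: norm_mult abs_minus_commute mult_left_le del: of_real_diff)
    moreover have "ew x - c * of_real (ev x) = (ew x - u n) + (u n - of_nat n * c) + c * of_real (real n - ev x)"
      by (simp add: algebra_simps)
    then have "cmod (ew x - c * of_real (ev x))
        \<le> cmod (ew x - u n) + cmod (u n - of_nat n * c) + cmod (c * of_real (real n - ev x))"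
      by (simp only:) (intro order_trans[OF norm_triangle_ineq] add_mono order_refl norm_triangle_ineq)
    ultimately have "cmod (ew x - c * of_real (ev x)) \<le> D + 3 * D + cmod c"
      using c[of n] by linarith
    moreover have "ew x - c * of_real (ev x) = (\<Sum>k\<in>A. \<alpha> ^ (3 * k + r) - c * of_real q ^ (3 * k + r))"
      by (simp add: evx ewx sum_subtractf sum_distrib_left)
    ultimately show "cmod (\<Sum>k\<in>A. \<alpha> ^ (3 * k + r) - c * of_real q ^ (3 * k + r)) \<le> D + 3 * D + cmod c"
      by simp
  qed
  \<comment> \<open>Subtracting \<open>q\<close> times the class 0 expression from the class 1
    expression eliminates \<open>c\<close>.\<close>
  have "(\<lambda>k. (\<alpha> ^ (3 * k + 1) - c * of_real q ^ (3 * k + 1))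
      - of_real q * (\<alpha> ^ (3 * k + 0) - c * of_real q ^ (3 * k + 0))) \<longlonglongrightarrow> 0 - of_real q * 0"
    by (intro tendsto_diff tendsto_mult tendsto_const lin) auto
  then have "(\<lambda>k. \<alpha> ^ (3 * k) * (\<alpha> - of_real q)) \<longlonglongrightarrow> 0"
    by (simp add: algebra_simps)
  then have lim: "(\<lambda>k. cmod (\<alpha> ^ (3 * k) * (\<alpha> - of_real q))) \<longlonglongrightarrow> 0"
    by (rule tendsto_norm_zero)
  show ?thesis
  proof (rule ccontr)
    assume "\<not> cmod \<alpha> < 1"
    then have ge: "cmod (\<alpha> - of_real q) \<le> cmod (\<alpha> ^ (3 * k) * (\<alpha> - of_real q))" for k
      by (simp add: norm_mult norm_power mult_le_cancel_right1)
    have "cmod (\<alpha> - of_real q) \<le> 0"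
      using lim by (rule LIMSEQ_le_const) (use ge in blast)
    with \<alpha> show False by simp
  qed
qed

lemma base_not_near_one: "\<not> q < 1 + 1/100"
proof
  assume "q < 1 + 1/100"
  obtain R where "lead_coeff R = 1" "poly (map_poly of_int R) q = 0" using monic_relation by blast
  then obtain U :: "int poly" where U: "lead_coeff U = 1" "coeff U 0 \<noteq> 0"
    "poly (map_poly of_int U) q = 0" "poly (map_poly of_int (pderiv U)) q \<noteq> 0"
    and conj: "\<And>S (\<alpha>::complex). poly (map_poly of_int S) q = 0 \<Longrightarrow> poly (map_poly of_int U) \<alpha> = 0
       \<Longrightarrow> poly (map_poly of_int S) \<alpha> = 0"
    using minimal_integer_polynomial[of q R] q1 by auto
  show False
    using no_pisot_near_one[OF q1 \<open>q < 1 + 1/100\<close> U] conjugate_norm_less_1 conj by blast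
qed

end

text \<open>If all nonzero values had modulus at least \<epsilon>, then
  \<open>separated_base\<close> would hold with gap \<epsilon>. The sign is adjusted by negating the
  polynomial.\<close>

lemma small_signed_power_sum:
  fixes q :: real
  assumes q: "1 < q" "q < 1 + 1/100" and "0 < \<epsilon>"
  obtains S :: "int poly" where "\<And>i. coeff S i \<in> {-1, 0, 1}"
    "0 < poly (map_poly of_int S) q" "poly (map_poly of_int S) q < \<epsilon>"
proof -
  have "\<exists>S :: int poly. (\<forall>i. coeff S i \<in> {-1, 0, 1}) \<and> poly (map_poly of_int S) q \<noteq> 0
      \<and> \<bar>poly (map_poly of_int S) q\<bar> < \<epsilon>"
  proof (rule ccontr)
    assume neg: "\<not> ?thesis"
    have "q ^ 3 \<le> (1 + 1/100) ^ 3" using q by (intro power_mono) auto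
    then have "q ^ 3 \<le> 2" by (simp add: power3_eq_cube)
    then interpret separated_base q \<epsilon>
      using neg assms by unfold_locales force+
    show False using base_not_near_one q by simp
  qed
  then obtain S :: "int poly" where S: "\<And>i. coeff S i \<in> {-1, 0, 1}"
    "poly (map_poly of_int S) q \<noteq> 0" "\<bar>poly (map_poly of_int S) q\<bar> < \<epsilon>" by auto
  show ?thesis
  proof (cases "poly (map_poly of_int S) q > 0")
    case True
    then show ?thesis using S by (intro that[of S]) auto
  next
    case False
    have "coeff (0 - S) i \<in> {-1, 0, 1}" for i using S(1)[of i] by auto
    moreover have "poly (map_poly of_int (0 - S)) q = - poly (map_poly of_int S) q"
      by (simp only: map_poly_of_int_diff) simp
    ultimately show ?thesis using S(2,3) False by (intro that[of "0 - S"]) auto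
  qed
qed

section \<open>Density of expanding orbits\<close>

text \<open>The covered interval grows by \<open>\<epsilon> / 2\<close> at a time. A signed sum of
  fresh powers with value \<open>g\<close> between \<open>\<epsilon> / 2\<close> and \<epsilon> is
  split by sign: its negative part joins the offset \<tau>, and taking the positive part instead of
  the negative one shifts the sum by \<open>g\<close>.\<close>

lemma power_sum_net:
  fixes Q :: real
  assumes Q: "1 < Q" "Q < 1 + 1/100" and \<epsilon>: "0 < \<epsilon>"
  obtains K \<tau> where "\<And>t. 0 \<le> t \<Longrightarrow> t \<le> R \<Longrightarrow> \<exists>E\<subseteq>{..<K}. \<bar>\<tau> + t - (\<Sum>k\<in>E. Q ^ k)\<bar> \<le> \<epsilon>"
proof -
  have *: "\<exists>K \<tau>. \<forall>t. 0 \<le> t \<and> t \<le> \<epsilon> + real M * (\<epsilon> / 2) \<longrightarrow> (\<exists>E\<subseteq>{..<K}. \<bar>\<tau> + t - (\<Sum>k\<in>E. Q ^ k)\<bar> \<le> \<epsilon>)" for M :: nat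
  proof (induction M)
    case 0
    show ?case by (intro exI[of _ 0]) auto
  next
    case (Suc M)
    define R where "R = \<epsilon> + real M * (\<epsilon> / 2)"
    have R\<epsilon>: "\<epsilon> \<le> R" using \<epsilon> by (simp add: R_def)
    obtain K \<tau> where K: "\<And>t. 0 \<le> t \<Longrightarrow> t \<le> R \<Longrightarrow> \<exists>E\<subseteq>{..<K}. \<bar>\<tau> + t - (\<Sum>k\<in>E. Q ^ k)\<bar> \<le> \<epsilon>"
      using Suc unfolding R_def by blast
    obtain S :: "int poly" where S: "\<And>i. coeff S i \<in> {-1, 0, 1}"
      "0 < poly (map_poly of_int S) Q" "poly (map_poly of_int S) Q < \<epsilon> / (2 * Q ^ K)"
      using small_signed_power_sum[OF Q, of "\<epsilon> / (2 * Q ^ K)"] \<epsilon> Q by auto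
    define s where "s = poly (map_poly of_int S) Q"
    obtain L0 where "\<epsilon> / (2 * s) < Q ^ L0" using real_arch_pow[OF Q(1)] by blast
    then have ex: "\<epsilon> / 2 < Q ^ L0 * s" using S by (simp add: s_def field_simps)
    \<comment> \<open>The first power of \<open>Q\<close> that lifts \<open>s\<close> above
      \<open>\<epsilon> / 2\<close> overshoots by at most the factor \<open>Q\<close>, so it stays
      within \<epsilon>. The smallness of \<open>s\<close> forces \<open>K < L\<close>, which makes
      the shifted exponents fresh.\<close>
    define L where "L = (LEAST L. \<epsilon> / 2 < Q ^ L * s)"
    have L: "\<epsilon> / 2 < Q ^ L * s" unfolding L_def using ex by (rule LeastI)
    have "K < L"
    proof (rule ccontr)
      assume "\<not> K < L"
      then have "Q ^ L * s \<le> Q ^ K * s" using Q S by (intro mult_right_mono power_increasing) (auto simp: s_def)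
      also have "\<dots> < \<epsilon> / 2" using S Q by (simp add: s_def field_simps)
      finally show False using L by simp
    qed
    have "\<not> \<epsilon> / 2 < Q ^ (L - 1) * s"
      using not_less_Least[of "L - 1" "\<lambda>L. \<epsilon> / 2 < Q ^ L * s"] \<open>K < L\<close> unfolding L_def[symmetric] by simp
    then have "Q * (Q ^ (L - 1) * s) \<le> Q * (\<epsilon> / 2)" using Q by (intro mult_left_mono) auto
    also have "\<dots> \<le> \<epsilon>" using Q \<epsilon> by simp
    finally have gle: "Q ^ L * s \<le> \<epsilon>" using \<open>K < L\<close> by (cases L) (auto simp: mult_ac)
    define g where "g = Q ^ L * s"
    define K' where "K' = L + degree S + 1"
    define I where "I c = {i. i \<le> degree S \<and> coeff S i = c}" for c
    define A where "A c = (\<lambda>i. L + i) ` I c" for c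
    have finI: "finite (I c)" for c unfolding I_def by simp
    have A: "A c \<subseteq> {K..<K'}" for c using \<open>K < L\<close> by (auto simp: A_def I_def K'_def)
    have sumA: "(\<Sum>k\<in>A c. Q ^ k) = Q ^ L * (\<Sum>i\<in>I c. Q ^ i)" for c
      unfolding A_def by (subst sum.reindex) (auto simp: power_add sum_distrib_left)
    have "s = (\<Sum>i\<le>degree S. of_int (coeff S i) * Q ^ i)"
      unfolding s_def poly_altdef by (simp add: degree_map_poly coeff_map_poly)
    also have "\<dots> = (\<Sum>i\<le>degree S. (if i \<in> I 1 then Q ^ i else 0) - (if i \<in> I (-1) then Q ^ i else 0))"
      using S(1) by (intro sum.cong) (auto simp: I_def)
    also have "\<dots> = (\<Sum>i\<in>I 1. Q ^ i) - (\<Sum>i\<in>I (-1). Q ^ i)"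
      unfolding sum_subtractf sum.inter_restrict[symmetric, OF finite_atMost]
      by (intro arg_cong2[where f="(-)"] sum.cong) (auto simp: I_def)
    finally have g: "g = (\<Sum>k\<in>A 1. Q ^ k) - (\<Sum>k\<in>A (-1). Q ^ k)"
      unfolding g_def sumA right_diff_distrib[symmetric] by simp
    have un: "(\<Sum>k\<in>E \<union> A c. Q ^ k) = (\<Sum>k\<in>E. Q ^ k) + (\<Sum>k\<in>A c. Q ^ k)" if "E \<subseteq> {..<K}" for E c
    proof (rule sum.union_disjoint)
      show "finite E" using that finite_subset by blast
      show "finite (A c)" using finI by (simp add: A_def)
      show "E \<inter> A c = {}" using that A[of c] by force
    qed
    have sub: "E \<union> A c \<subseteq> {..<K'}" if "E \<subseteq> {..<K}" for E c
      using that A[of c] \<open>K < L\<close> unfolding K'_def by force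
    show ?case
    proof (intro exI[of _ K'] exI[of _ "\<tau> + (\<Sum>k\<in>A (-1). Q ^ k)"] allI impI)
      fix t assume t: "0 \<le> t \<and> t \<le> \<epsilon> + real (Suc M) * (\<epsilon> / 2)"
      then have tR: "t \<le> R + \<epsilon> / 2" by (simp add: R_def field_simps)
      show "\<exists>E\<subseteq>{..<K'}. \<bar>\<tau> + (\<Sum>k\<in>A (-1). Q ^ k) + t - (\<Sum>k\<in>E. Q ^ k)\<bar> \<le> \<epsilon>"
      proof (cases "t \<le> R")
        case True
        then obtain E where E: "E \<subseteq> {..<K}" "\<bar>\<tau> + t - (\<Sum>k\<in>E. Q ^ k)\<bar> \<le> \<epsilon>" using K t by blast
        then show ?thesis using un[OF E(1), of "-1"] sub[OF E(1), of "-1"]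
          by (intro exI[of _ "E \<union> A (-1)"]) simp
      next
        case False
        \<comment> \<open>Here \<open>g \<le> \<epsilon> \<le> R < t\<close> while \<open>g\<close>
          exceeds \<open>\<epsilon> / 2\<close>, so \<open>t - g\<close> falls back into the
          interval already covered.\<close>
        then have "0 \<le> t - g" "t - g \<le> R" using tR gle L R\<epsilon> unfolding g_def by linarith+
        then obtain E where E: "E \<subseteq> {..<K}" "\<bar>\<tau> + (t - g) - (\<Sum>k\<in>E. Q ^ k)\<bar> \<le> \<epsilon>" using K by blast
        then show ?thesis using un[OF E(1), of 1] sub[OF E(1), of 1] g
          by (intro exI[of _ "E \<union> A 1"]) (simp add: algebra_simps)
      qed
    qed
  qed
  obtain M where "R / (\<epsilon> / 2) < real M" using reals_Archimedean2 by blast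
  then have "R \<le> \<epsilon> + real M * (\<epsilon> / 2)" using \<epsilon> by (simp add: field_simps)
  with *[of M] show ?thesis using that by (meson order_trans)
qed

text \<open>At most \<open>n + 1\<close> barycentric coordinates sum to 1, so one of them is at
  least \<open>w / W\<close>. Taking \<open>w / W\<close> off it and rescaling leaves convex
  coefficients. The lemma drives the greedy digits and, with \<open>W = 1\<close>, the
  self-similarity of the hull.\<close>

lemma convex_hull_image_step:
  fixes p :: "nat \<Rightarrow> 'a::real_vector"
  assumes x: "x \<in> convex hull (p ` {..n})" and n: "1 \<le> n"
    and w: "0 \<le> w" "real (n + 1) * w \<le> W"
  obtains i x' where "i \<le> n" "x' \<in> convex hull (p ` {..n})" "W *\<^sub>R x = w *\<^sub>R p i + (W - w) *\<^sub>R x'"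
proof (cases "w = 0")
  case True
  then show ?thesis using x by (intro that[of 0 x]) auto
next
  case False
  then have w0: "0 < w" using w by simp
  have "2 * w \<le> real (n + 1) * w" using n w by (intro mult_right_mono) auto
  then have Ww: "w < W" using w w0 by linarith
  define S where "S = p ` {..n}"
  have fS: "finite S" and cS: "card S \<le> n + 1" and S0: "S \<noteq> {}"
    using card_image_le[of "{..n}" p] by (auto simp: S_def)
  obtain u where u: "\<forall>y\<in>S. 0 \<le> u y" "sum u S = 1" "(\<Sum>y\<in>S. u y *\<^sub>R y) = x"
    using x convex_hull_finite[OF fS] unfolding S_def[symmetric] by auto
  have "\<exists>y\<in>S. w \<le> W * u y"
  proof (rule ccontr)
    assume "\<not> ?thesis"
    then have "(\<Sum>y\<in>S. W * u y) < (\<Sum>y\<in>S. w)" using fS S0 by (intro sum_strict_mono) auto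
    then have "W < real (card S) * w" using u by (simp add: sum_distrib_left[symmetric])
    also have "\<dots> \<le> real (n + 1) * w" using cS w by (intro mult_right_mono) auto
    finally show False using w by simp
  qed
  then obtain y where y: "y \<in> S" "w \<le> W * u y" by blast
  then obtain i where i: "i \<le> n" "y = p i" by (auto simp: S_def)
  define u' where "u' z = (W * u z - (if z = y then w else 0)) / (W - w)" for z
  have "\<forall>z\<in>S. 0 \<le> u' z" using u y Ww w by (auto simp: u'_def)
  moreover have "sum u' S = 1"
  proof -
    have "sum u' S = (W * sum u S - (\<Sum>z\<in>S. if z = y then w else 0)) / (W - w)"
      unfolding u'_def by (simp add: sum_subtractf sum_distrib_left flip: sum_divide_distrib)
    also have "\<dots> = 1" using fS y u Ww by simp
    finally show ?thesis .
  qed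
  ultimately have x': "(\<Sum>z\<in>S. u' z *\<^sub>R z) \<in> convex hull S"
    unfolding convex_hull_finite[OF fS] by blast
  have "(W - w) *\<^sub>R (\<Sum>z\<in>S. u' z *\<^sub>R z) = (\<Sum>z\<in>S. (W * u z) *\<^sub>R z - (if z = y then w *\<^sub>R z else 0))"
  proof -
    have "(W - w) * u' z = W * u z - (if z = y then w else 0)" for z
      using Ww by (simp add: u'_def)
    then show ?thesis
      unfolding scaleR_sum_right scaleR_scaleR by (intro sum.cong) (simp_all add: scaleR_diff_left)
  qed
  also have "\<dots> = W *\<^sub>R x - w *\<^sub>R y"
    using fS y by (simp add: sum_subtractf sum.delta scaleR_sum_right flip: u(3))
  finally show ?thesis using i x' by (intro that[of i]) (auto simp: S_def)
qed

text \<open>Digits are chosen from the largest index downwards, each choice leaving a target of the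
  same shape with the next smaller total weight. Below \<open>k0\<close> all digits are 0; the whole
  error arises there, so it does not depend on \<open>m\<close>.\<close>

lemma greedy_digits:
  fixes p :: "nat \<Rightarrow> 'a::euclidean_space" and w :: "nat \<Rightarrow> real"
  defines "W \<equiv> \<lambda>k. \<Sum>j<k. w j"
  assumes n: "1 \<le> n" and w0: "\<And>j. 0 \<le> w j"
    and w: "\<And>k. k0 \<le> k \<Longrightarrow> real (n + 1) * w k \<le> W (Suc k)"
    and B: "\<And>z. z \<in> convex hull (p ` {..n}) \<Longrightarrow> norm z \<le> B"
    and m: "k0 \<le> m" and x: "x \<in> convex hull (p ` {..n})"
  obtains c where "\<And>j. c j \<le> n" "norm (W m *\<^sub>R x - (\<Sum>j<m. w j *\<^sub>R p (c j))) \<le> 2 * W k0 * B"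
proof -
  have pB: "norm (p i) \<le> B" if "i \<le> n" for i using that by (intro B hull_inc) auto
  have Wk0: "0 \<le> W k0" unfolding W_def using w0 by (simp add: sum_nonneg)
  have "\<exists>c. (\<forall>j. c j \<le> n) \<and> norm (W m *\<^sub>R x - (\<Sum>j<m. w j *\<^sub>R p (c j))) \<le> 2 * W k0 * B"
    using m x
  proof (induction arbitrary: x rule: dec_induct)
    case base
    have "norm (W k0 *\<^sub>R x - (\<Sum>j<k0. w j *\<^sub>R p 0)) = W k0 * norm (x - p 0)"
    proof -
      have "W k0 *\<^sub>R x - (\<Sum>j<k0. w j *\<^sub>R p 0) = W k0 *\<^sub>R (x - p 0)"
        by (simp add: W_def scaleR_diff_right scaleR_sum_left)
      then show ?thesis using Wk0 by simp
    qed
    also have "\<dots> \<le> W k0 * (B + B)"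
      using Wk0 B[OF base] pB[of 0] by (intro mult_left_mono order_trans[OF norm_triangle_ineq4] add_mono) auto
    finally show ?case by (intro exI[of _ "\<lambda>_. 0"]) (simp add: algebra_simps)
  next
    case (step m)
    obtain i x' where ix: "i \<le> n" "x' \<in> convex hull (p ` {..n})"
      "W (Suc m) *\<^sub>R x = w m *\<^sub>R p i + (W (Suc m) - w m) *\<^sub>R x'"
      using convex_hull_image_step[OF step.prems n w0 w[OF step.hyps(1)]] by blast
    obtain c where c: "\<And>j. c j \<le> n" "norm (W m *\<^sub>R x' - (\<Sum>j<m. w j *\<^sub>R p (c j))) \<le> 2 * W k0 * B"
      using step.IH[OF ix(2)] by blast
    have "(\<Sum>j<Suc m. w j *\<^sub>R p ((c(m := i)) j)) = w m *\<^sub>R p i + (\<Sum>j<m. w j *\<^sub>R p (c j))"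
      by simp
    moreover have "W (Suc m) - w m = W m" by (simp add: W_def)
    ultimately have "W (Suc m) *\<^sub>R x - (\<Sum>j<Suc m. w j *\<^sub>R p ((c(m := i)) j)) = W m *\<^sub>R x' - (\<Sum>j<m. w j *\<^sub>R p (c j))"
      using ix(3) by (simp only:) simp
    then show ?case using c ix(1) by (intro exI[of _ "c(m := i)"]) (simp only:, simp)
  qed
  then show ?thesis using that by blast
qed

text \<open>Full affine dimension makes the differences \<open>p i - p 0\<close> span the space.
  Coefficients are fixed on the standard basis and extended linearly, which yields the bound; the
  differences may be linearly dependent.\<close>

lemma affine_coordinates:
  fixes p :: "nat \<Rightarrow> 'a::euclidean_space"
  assumes inj: "inj_on p {..n}" and full: "aff_dim (p ` {..n}) = int DIM('a)"
  obtains g :: "'a \<Rightarrow> nat \<Rightarrow> real" and C where "0 \<le> C"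
    "\<And>h. h = (\<Sum>i=1..n. g h i *\<^sub>R (p i - p 0))" "\<And>h i. \<bar>g h i\<bar> \<le> C * norm h"
proof -
  define v where "v i = p i - p 0" for i
  have "affine hull (p ` {..n}) = UNIV" using full by (simp add: aff_dim_eq_full)
  moreover have "(\<lambda>x. - p 0 + x) ` (p ` {..n} - {p 0}) = v ` {1..n}"
  proof -
    have "p ` {..n} - {p 0} = p ` {1..n}"
    proof -
      have "{..n} = insert 0 {1..n}" by auto
      moreover have "p 0 \<notin> p ` {1..n}"
      proof
        assume "p 0 \<in> p ` {1..n}"
        then obtain i where "i \<in> {1..n}" "p 0 = p i" by blast
        then show False using inj_onD[OF inj, of 0 i] by simp
      qed
      ultimately show ?thesis by simp
    qed
    then show ?thesis by (simp add: image_image v_def)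
  qed
  ultimately have "(\<lambda>x. p 0 + x) ` span (v ` {1..n}) = UNIV"
    using affine_hull_span2[of "p 0" "p ` {..n}"] by simp
  then have span: "span (v ` {1..n}) = UNIV"
  proof -
    assume eq: "(\<lambda>x. p 0 + x) ` span (v ` {1..n}) = UNIV"
    have "h \<in> span (v ` {1..n})" for h
    proof -
      have "p 0 + h \<in> (\<lambda>x. p 0 + x) ` span (v ` {1..n})" unfolding eq by simp
      then show ?thesis by auto
    qed
    then show ?thesis by auto
  qed
  have "\<exists>\<beta>. b = (\<Sum>i=1..n. \<beta> i *\<^sub>R v i)" for b :: 'a
  proof -
    have "b \<in> span (v ` {1..n})" unfolding span by simp
    then obtain u where "b = (\<Sum>y\<in>v ` {1..n}. u y *\<^sub>R y)" using span_finite[of "v ` {1..n}"] by auto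
    moreover have "inj_on v {1..n}"
      by (rule inj_onI) (use inj_onD[OF inj] in \<open>simp add: v_def\<close>)
    ultimately have "b = (\<Sum>i=1..n. u (v i) *\<^sub>R v i)" by (simp add: sum.reindex)
    then show ?thesis by (intro exI[of _ "\<lambda>i. u (v i)"])
  qed
  then obtain \<beta> where \<beta>: "\<And>b :: 'a. b = (\<Sum>i=1..n. \<beta> b i *\<^sub>R v i)" by metis
  define g where "g h i = (if i \<in> {1..n} then \<Sum>b\<in>Basis. (h \<bullet> b) * \<beta> b i else 0)" for h i
  define C where "C = (\<Sum>i=1..n. \<Sum>b\<in>Basis. \<bar>\<beta> b i\<bar>)"
  show ?thesis
  proof
    show "0 \<le> C" unfolding C_def by (intro sum_nonneg) auto
    fix h :: 'a
    have "h = (\<Sum>b\<in>Basis. (h \<bullet> b) *\<^sub>R b)" by (simp add: euclidean_representation)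
    also have "\<dots> = (\<Sum>b\<in>Basis. (h \<bullet> b) *\<^sub>R (\<Sum>i=1..n. \<beta> b i *\<^sub>R v i))"
      using \<beta> by simp
    also have "\<dots> = (\<Sum>i=1..n. \<Sum>b\<in>Basis. ((h \<bullet> b) * \<beta> b i) *\<^sub>R v i)"
      unfolding scaleR_sum_right by (subst sum.swap) simp
    also have "\<dots> = (\<Sum>i=1..n. g h i *\<^sub>R v i)"
      by (intro sum.cong) (simp_all add: g_def scaleR_sum_left)
    finally show "h = (\<Sum>i=1..n. g h i *\<^sub>R (p i - p 0))" by (simp add: v_def)
    fix i
    show "\<bar>g h i\<bar> \<le> C * norm h"
    proof (cases "i \<in> {1..n}")
      case True
      have "\<bar>g h i\<bar> \<le> (\<Sum>b\<in>Basis. \<bar>(h \<bullet> b) * \<beta> b i\<bar>)" using True by (simp add: g_def sum_abs)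
      also have "\<dots> \<le> (\<Sum>b\<in>Basis. \<bar>\<beta> b i\<bar> * norm h)"
        by (intro sum_mono) (simp add: abs_mult mult.commute[of "norm h"] mult.commute[of "\<bar>h \<bullet> _\<bar>"] Basis_le_norm mult_left_mono)
      also have "\<dots> = (\<Sum>b\<in>Basis. \<bar>\<beta> b i\<bar>) * norm h" by (simp add: sum_distrib_right)
      also have "\<dots> \<le> C * norm h"
        unfolding C_def using True
        by (intro mult_right_mono member_le_sum[of i "{1..n}" "\<lambda>i. \<Sum>b\<in>Basis. \<bar>\<beta> b i\<bar>"]) (auto intro: sum_nonneg)
      finally show ?thesis .
    qed (auto simp: g_def \<open>0 \<le> C\<close>)
  qed
qed

text \<open>The weights at multiples of \<open>N\<close> suffice: with \<open>Q = q ^ N\<close> they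
  sum to at least \<open>(q - 1) * (q ^ k - 1) / (Q - 1)\<close>. Now
  \<open>N * (Q - 1) \<le> 1/2\<close> and \<open>q ^ k / 2 \<le> q ^ k - 1\<close> give the
  claim.\<close>

lemma power_weights_greedy:
  fixes q :: real
  assumes q: "1 < q" and N: "1 \<le> N" "real N * (q ^ N - 1) \<le> 1/2" and k: "2 \<le> q ^ k"
    and A: "\<And>l. N * l \<in> A"
  shows "real N * ((q - 1) * q ^ k) \<le> (\<Sum>j<Suc k. if j \<in> A then (q - 1) * q ^ j else 0)"
proof -
  define Q where "Q = q ^ N"
  define b where "b = k div N"
  have Q1: "1 < Q" unfolding Q_def using q N by (intro one_less_power) auto
  have "N * (k div N) + k mod N = k" "k mod N < N" using N by auto
  then have kb: "k \<le> N * Suc b" unfolding b_def mult_Suc_right by linarith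
  have "q ^ k \<le> Q ^ Suc b" unfolding Q_def power_mult[symmetric] using q kb by (intro power_increasing) auto
  then have "real N * q ^ k \<le> (q ^ k - 1) / (Q - 1)"
  proof -
    have "real N * q ^ k * (Q - 1) \<le> q ^ k / 2"
      using mult_right_mono[OF N(2), of "q ^ k"] q by (simp add: Q_def mult_ac)
    also have "\<dots> \<le> q ^ k - 1" using k by simp
    finally show ?thesis using Q1 by (simp add: pos_le_divide_eq)
  qed
  also have "\<dots> \<le> (Q ^ Suc b - 1) / (Q - 1)"
    using Q1 \<open>q ^ k \<le> Q ^ Suc b\<close> by (intro divide_right_mono) auto
  also have "\<dots> = (\<Sum>l<Suc b. Q ^ l)" using Q1 by (simp only: geometric_sum[of Q "Suc b"])
  finally have "(q - 1) * (real N * q ^ k) \<le> (q - 1) * (\<Sum>l<Suc b. Q ^ l)"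
    using q by (intro mult_left_mono) auto
  also have "\<dots> = (\<Sum>j\<in>(\<lambda>l. N * l) ` {..<Suc b}. if j \<in> A then (q - 1) * q ^ j else 0)"
    using N A by (subst sum.reindex) (auto simp: inj_on_def Q_def power_mult sum_distrib_left simp del: sum.lessThan_Suc)
  also have "\<dots> \<le> (\<Sum>j<Suc k. if j \<in> A then (q - 1) * q ^ j else 0)"
  proof (rule sum_mono2)
    have "N * l \<le> k" if "l \<le> b" for l
      using that N unfolding b_def by (simp add: less_eq_div_iff_mult_less_eq mult.commute)
    then show "(\<lambda>l. N * l) ` {..<Suc b} \<subseteq> {..<Suc k}" by (auto simp: less_Suc_eq_le)
  qed (use q in auto)
  finally show ?thesis by (simp add: mult_ac)
qed

text \<open>The vector \<open>q ^ m *\<^sub>R x - y\<close> has to be a digit sum up to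
  \<open>e\<close>. Greedy coarse digits leave an error \<open>h\<close>, and finitely many fine
  digits correct its coordinates through \<open>power_sum_net\<close>. The bound on \<open>h\<close>
  is available before the fine digits and \<open>m\<close> are chosen, which avoids
  circularity.\<close>

lemma expanding_orbit_dense:
  fixes p :: "nat \<Rightarrow> 'a::euclidean_space" and q :: real
  assumes inj: "inj_on p {..n}" and full: "aff_dim (p ` {..n}) = int DIM('a)"
    and q: "1 < q" "q ^ (n + 1) < 1 + 1/100" "real (n + 1) * (q ^ (n + 1) - 1) \<le> 1/2"
    and x: "x \<in> interior (convex hull (p ` {..n}))" and e: "0 < e"
  obtains m d where "\<And>j. d j \<le> n"
    "dist (q ^ m *\<^sub>R x - (q - 1) *\<^sub>R (\<Sum>j<m. q ^ j *\<^sub>R p (d j))) y < e"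
proof -
  define N where "N = n + 1"
  define Q where "Q = q ^ N"
  define H where "H = convex hull (p ` {..n})"
  define v where "v i = p i - p 0" for i
  have n1: "1 \<le> n"
  proof (rule ccontr)
    assume "\<not> 1 \<le> n"
    then have "n = 0" by simp
    then have "int DIM('a) = 0" using full by simp
    then show False using DIM_positive[where 'a='a] by simp
  qed
  have Q1: "1 < Q" unfolding Q_def N_def using q by (intro one_less_power) auto
  obtain g C where C: "0 \<le> C" and g: "\<And>h. h = (\<Sum>i=1..n. g h i *\<^sub>R v i)" "\<And>h i. \<bar>g h i\<bar> \<le> C * norm h"
    using affine_coordinates[OF inj full] unfolding v_def by metis
  have "compact H" unfolding H_def by (intro finite_imp_compact_convex_hull) auto
  then obtain B where B: "\<And>z. z \<in> H \<Longrightarrow> norm z \<le> B"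
    using compact_imp_bounded bounded_iff by metis
  have "x \<in> H" using x interior_subset[of H] unfolding H_def by blast
  then have B0: "0 \<le> B" using B[of x] norm_ge_zero[of x] by linarith
  obtain k0 where k0: "2 < q ^ k0" using real_arch_pow[OF q(1)] by blast
  \<comment> \<open>\<open>R0\<close> bounds the greedy error and \<open>R1\<close> its coordinates
    divided by the weights \<open>(q - 1) * q ^ i\<close>. The window \<open>R\<close> is twice
    \<open>R1\<close>, so corrections of either sign around \<open>R / 2\<close> stay inside
    it.\<close>
  define R0 where "R0 = 2 * q ^ k0 * B"
  define R1 where "R1 = C * R0 / (q - 1)"
  define R where "R = 2 * R1"
  define V where "V = (\<Sum>i=1..n. (q - 1) * q ^ i * norm (v i))"
  define \<epsilon> where "\<epsilon> = e / (2 * (V + 1))"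
  have V0: "0 \<le> V" unfolding V_def using q by (intro sum_nonneg) auto
  have \<epsilon>: "0 < \<epsilon>" using e V0 by (simp add: \<epsilon>_def)
  have \<epsilon>V: "\<epsilon> * V < e"
  proof -
    have "\<epsilon> * V \<le> \<epsilon> * (V + 1)" using \<epsilon> by simp
    also have "\<dots> = e / 2" using V0 by (simp add: \<epsilon>_def field_simps)
    finally show ?thesis using e by simp
  qed
  obtain K \<tau> where net: "\<And>t. 0 \<le> t \<Longrightarrow> t \<le> R \<Longrightarrow> \<exists>E\<subseteq>{..<K}. \<bar>\<tau> + t - (\<Sum>k\<in>E. Q ^ k)\<bar> \<le> \<epsilon>"
    using power_sum_net[OF Q1 _ \<epsilon>, of R] q(2) unfolding Q_def N_def by blast
  txt \<open>The exponents in \<open>F\<close> form the fine digits: those congruent to \<open>i\<close> modulo \<open>N\<close> choose between \<open>p 0\<close> and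
    \<open>p i\<close> and realise the net in direction \<open>v i\<close>. All others are chosen greedily, with an error \<open>R0\<close>
    independent of \<open>K\<close>.\<close>
  define F where "F = {j. j < N * K \<and> j mod N \<noteq> 0}"
  define w where "w j = (if j \<in> - F then (q - 1) * q ^ j else 0)" for j
  have reindex: "(\<Sum>j\<in>F. f j) = (\<Sum>i=1..n. \<Sum>k<K. f (N * k + i))" for f :: "nat \<Rightarrow> 'a"
  proof -
    have "(\<Sum>i=1..n. \<Sum>k<K. f (N * k + i)) = (\<Sum>(i, k)\<in>{1..n} \<times> {..<K}. f (N * k + i))"
      by (simp add: sum.cartesian_product)
    also have "\<dots> = (\<Sum>j\<in>F. f j)"
    proof (rule sum.reindex_bij_witness[of _ "\<lambda>j. (j mod N, j div N)" "\<lambda>(i, k). N * k + i"])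
      fix a assume a: "a \<in> {1..n} \<times> {..<K}"
      then obtain i k where ik: "a = (i, k)" "1 \<le> i" "i < N" "k < K" by (auto simp: N_def)
      have "N * k + i < N * Suc k" using ik by simp
      also have "\<dots> \<le> N * K" using ik by (intro mult_le_mono2) simp
      finally show "(case a of (i, k) \<Rightarrow> N * k + i) \<in> F" using ik by (simp add: F_def)
      show "(\<lambda>j. (j mod N, j div N)) (case a of (i, k) \<Rightarrow> N * k + i) = a" using ik by simp
    next
      fix j assume j: "j \<in> F"
      show "(case (j mod N, j div N) of (i, k) \<Rightarrow> N * k + i) = j" by simp
      have "j div N < K" using j by (simp add: F_def less_mult_imp_div_less mult.commute)
      moreover have "j mod N < N" by (simp add: N_def)
      ultimately show "(j mod N, j div N) \<in> {1..n} \<times> {..<K}" using j by (simp add: F_def N_def)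
    qed auto
    finally show ?thesis by simp
  qed
  \<comment> \<open>The contribution of the fine digits if every net realised the centre
    \<open>\<tau> + R / 2\<close> exactly; \<open>wf\<close> below is the total weight of their
    positions.\<close>
  define zs where "zs = (q - 1) *\<^sub>R (\<Sum>j\<in>F. q ^ j *\<^sub>R p 0) + (\<Sum>i=1..n. ((q - 1) * q ^ i * (\<tau> + R / 2)) *\<^sub>R v i)"
  define wf where "wf = (\<Sum>j\<in>F. (q - 1) * q ^ j)"
  define W where "W k = (\<Sum>j<k. w j)" for k
  have geo: "(\<Sum>j<k. (q - 1) * q ^ j) = q ^ k - 1" for k
    using q geometric_sum[of q k] by (simp add: sum_distrib_left[symmetric])
  have Wm: "W m = q ^ m - 1 - wf" if "N * K \<le> m" for m
  proof -
    have "F \<subseteq> {..<m}" using that by (auto simp: F_def)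
    then have "(\<Sum>j<m. (q - 1) * q ^ j) = wf + (\<Sum>j\<in>{..<m} - F. (q - 1) * q ^ j)"
      unfolding wf_def by (metis finite_lessThan sum.subset_diff add.commute)
    moreover have "W m = (\<Sum>j\<in>{..<m} - F. (q - 1) * q ^ j)"
      unfolding W_def w_def by (simp add: sum.If_cases Diff_eq Compl_eq)
    ultimately show ?thesis by (simp add: geo)
  qed
  \<comment> \<open>The target left to the greedy digits, divided by their total weight. It tends to
    \<open>x\<close>, so for large \<open>m\<close> it lies in the hull because \<open>x\<close> is
    an interior point.\<close>
  define xm where "xm m = (1 / (q ^ m - 1 - wf)) *\<^sub>R (q ^ m *\<^sub>R x - y - zs)" for m
  have inv0: "(\<lambda>m. (1 / q) ^ m) \<longlonglongrightarrow> 0" using q by (intro LIMSEQ_realpow_zero) auto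
  have "(\<lambda>m. (1 / (1 - (1 / q) ^ m * (1 + wf))) *\<^sub>R (x - (1 / q) ^ m *\<^sub>R (y + zs)))
      \<longlonglongrightarrow> (1 / (1 - 0 * (1 + wf))) *\<^sub>R (x - 0 *\<^sub>R (y + zs))"
    by (intro tendsto_intros inv0) auto
  moreover have "(1 / (1 - (1 / q) ^ m * (1 + wf))) *\<^sub>R (x - (1 / q) ^ m *\<^sub>R (y + zs)) = xm m" for m
  proof -
    have qm: "q ^ m \<noteq> 0" using q by simp
    have "x - (1 / q) ^ m *\<^sub>R (y + zs) = (1 / q ^ m) *\<^sub>R (q ^ m *\<^sub>R x - y - zs)"
      using qm q(1) by (simp add: power_one_over scaleR_diff_right scaleR_add_right algebra_simps inverse_eq_divide)
    moreover have "1 / (1 - (1 / q) ^ m * (1 + wf)) * (1 / q ^ m) = 1 / (q ^ m - 1 - wf)"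
    proof -
      have "q ^ m * (1 - (1 / q) ^ m * (1 + wf)) = q ^ m - 1 - wf"
        using qm q(1) by (simp add: power_one_over field_simps)
      moreover have "1 / a * (1 / b) = 1 / (b * a)" for a b :: real by simp
      ultimately show ?thesis by (simp only:)
    qed
    ultimately show ?thesis by (simp add: xm_def)
  qed
  ultimately have "xm \<longlonglongrightarrow> x" by simp
  then have ev1: "\<forall>\<^sub>F m in sequentially. xm m \<in> interior H"
    using x unfolding H_def by (intro topological_tendstoD) auto
  have "\<forall>\<^sub>F m in sequentially. 1 + wf < q ^ m"
  proof -
    obtain M where M: "1 + wf < q ^ M" using real_arch_pow[OF q(1)] by blast
    have "1 + wf < q ^ m" if "M \<le> m" for m
      using M power_increasing[OF that, of q] q by linarith
    then show ?thesis by (auto simp: eventually_sequentially)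
  qed
  then have "\<forall>\<^sub>F m in sequentially. xm m \<in> interior H \<and> 1 + wf < q ^ m \<and> N * K \<le> m \<and> k0 \<le> m"
    using ev1 eventually_ge_at_top[of "N * K"] eventually_ge_at_top[of k0]
    by (intro eventually_conj) auto
  from eventually_happens'[OF sequentially_bot this]
  obtain m where m: "xm m \<in> interior H" "1 + wf < q ^ m" "N * K \<le> m" "k0 \<le> m" by blast
  have xmH: "xm m \<in> convex hull (p ` {..n})" using m(1) interior_subset unfolding H_def by blast
  have w0: "0 \<le> w j" for j using q by (simp add: w_def)
  have wk: "real (n + 1) * w k \<le> (\<Sum>j<Suc k. w j)" if "k0 \<le> k" for k
  proof (cases "k \<in> F")
    case True
    then show ?thesis using w0 by (simp add: w_def sum_nonneg del: sum.lessThan_Suc)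
  next
    case False
    have "q ^ k0 \<le> q ^ k" using q that by (intro power_increasing) auto
    then have "2 \<le> q ^ k" using k0 by linarith
    moreover have "N * l \<in> - F" for l by (simp add: F_def)
    moreover have "1 \<le> N" "real N * (q ^ N - 1) \<le> 1/2" using q(3) by (simp_all only: N_def)
    ultimately have "real N * ((q - 1) * q ^ k) \<le> (\<Sum>j<Suc k. if j \<in> - F then (q - 1) * q ^ j else 0)"
      using q(1) by (intro power_weights_greedy)
    then show ?thesis using False by (simp add: w_def N_def)
  qed
  obtain c where c: "\<And>j. c j \<le> n" "norm (W m *\<^sub>R xm m - (\<Sum>j<m. w j *\<^sub>R p (c j))) \<le> 2 * W k0 * B"
    using greedy_digits[OF n1 w0 wk B[unfolded H_def] m(4) xmH] unfolding W_def by blast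
  define h where "h = W m *\<^sub>R xm m - (\<Sum>j<m. w j *\<^sub>R p (c j))"
  have Wx: "W m *\<^sub>R xm m = q ^ m *\<^sub>R x - y - zs" using m(2) by (simp add: Wm[OF m(3)] xm_def)
  have "W k0 \<le> q ^ k0"
  proof -
    have "W k0 \<le> (\<Sum>j<k0. (q - 1) * q ^ j)" unfolding W_def w_def using q by (intro sum_mono) auto
    then show ?thesis by (simp add: geo)
  qed
  then have "2 * W k0 * B \<le> R0" unfolding R0_def using B0 by (intro mult_right_mono) auto
  then have hR: "norm h \<le> R0" using c(2) by (simp add: h_def)
  define t where "t i = R / 2 + g h i / ((q - 1) * q ^ i)" for i
  have t: "0 \<le> t i \<and> t i \<le> R" for i
  proof -
    have "\<bar>g h i / ((q - 1) * q ^ i)\<bar> = \<bar>g h i\<bar> / ((q - 1) * q ^ i)" using q by (simp add: abs_mult)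
    also have "\<dots> \<le> \<bar>g h i\<bar> / (q - 1)"
      using q by (intro divide_left_mono) (auto simp: one_le_power)
    also have "\<dots> \<le> R1"
      unfolding R1_def using q C hR by (intro divide_right_mono order_trans[OF g(2)] mult_left_mono) auto
    finally have "\<bar>g h i / ((q - 1) * q ^ i)\<bar> \<le> R / 2" by (simp add: R_def)
    then show ?thesis unfolding t_def by linarith
  qed
  have "\<forall>i. \<exists>E\<subseteq>{..<K}. \<bar>\<tau> + t i - (\<Sum>k\<in>E. Q ^ k)\<bar> \<le> \<epsilon>" using net t by blast
  then obtain E where E: "\<And>i. E i \<subseteq> {..<K}" "\<And>i. \<bar>\<tau> + t i - (\<Sum>k\<in>E i. Q ^ k)\<bar> \<le> \<epsilon>"
    by metis
  define d where "d j = (if j \<in> F then if j div N \<in> E (j mod N) then j mod N else 0 else c j)" for j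
  show ?thesis
  proof (rule that)
    show "d j \<le> n" for j
    proof -
      have "j mod N < N" by (simp add: N_def)
      then show ?thesis using c(1)[of j] by (simp add: d_def N_def)
    qed
    have "(\<Sum>j<m. ((q - 1) * q ^ j) *\<^sub>R p (d j))
        = (\<Sum>j<m. w j *\<^sub>R p (c j)) + (\<Sum>j\<in>F. ((q - 1) * q ^ j) *\<^sub>R p (d j))"
    proof -
      have "F \<subseteq> {..<m}" using m(3) by (auto simp: F_def)
      then have eq: "(\<Sum>j\<in>F. ((q - 1) * q ^ j) *\<^sub>R p (d j)) = (\<Sum>j<m. if j \<in> F then ((q - 1) * q ^ j) *\<^sub>R p (d j) else 0)"
        by (simp add: sum.inter_restrict[symmetric] Int_absorb1)
      show ?thesis
        unfolding eq sum.distrib[symmetric] by (intro sum.cong) (auto simp: w_def d_def)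
    qed
    moreover have "(\<Sum>j\<in>F. ((q - 1) * q ^ j) *\<^sub>R p (d j))
        = (q - 1) *\<^sub>R (\<Sum>j\<in>F. q ^ j *\<^sub>R p 0) + (\<Sum>i=1..n. ((q - 1) * q ^ i * (\<Sum>k\<in>E i. Q ^ k)) *\<^sub>R v i)"
    proof -
      have "(\<Sum>j\<in>F. ((q - 1) * q ^ j) *\<^sub>R p (d j)) = (\<Sum>j\<in>F. ((q - 1) * q ^ j) *\<^sub>R p 0
          + (if j div N \<in> E (j mod N) then ((q - 1) * q ^ j) *\<^sub>R v (j mod N) else 0))"
        by (intro sum.cong) (auto simp: d_def v_def algebra_simps)
      also have "\<dots> = (q - 1) *\<^sub>R (\<Sum>j\<in>F. q ^ j *\<^sub>R p 0)
          + (\<Sum>j\<in>F. if j div N \<in> E (j mod N) then ((q - 1) * q ^ j) *\<^sub>R v (j mod N) else 0)"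
        by (simp add: sum.distrib scaleR_sum_right)
      also have "(\<Sum>j\<in>F. if j div N \<in> E (j mod N) then ((q - 1) * q ^ j) *\<^sub>R v (j mod N) else 0)
          = (\<Sum>i=1..n. \<Sum>k<K. if k \<in> E i then ((q - 1) * q ^ (N * k + i)) *\<^sub>R v i else 0)"
        unfolding reindex by (intro sum.cong) (auto simp: N_def simp del: One_nat_def)
      also have "\<dots> = (\<Sum>i=1..n. ((q - 1) * q ^ i * (\<Sum>k\<in>E i. Q ^ k)) *\<^sub>R v i)"
      proof (rule sum.cong)
        fix i
        have "(\<Sum>k<K. if k \<in> E i then ((q - 1) * q ^ (N * k + i)) *\<^sub>R v i else 0)
            = (\<Sum>k\<in>E i. ((q - 1) * q ^ (N * k + i)) *\<^sub>R v i)"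
          using E(1)[of i] by (simp add: sum.inter_restrict[symmetric] Int_absorb1)
        also have "\<dots> = ((q - 1) * q ^ i * (\<Sum>k\<in>E i. Q ^ k)) *\<^sub>R v i"
          unfolding scaleR_sum_left[symmetric] sum_distrib_left Q_def power_mult[symmetric]
          by (simp add: power_add mult_ac)
        finally show "(\<Sum>k<K. if k \<in> E i then ((q - 1) * q ^ (N * k + i)) *\<^sub>R v i else 0)
            = ((q - 1) * q ^ i * (\<Sum>k\<in>E i. Q ^ k)) *\<^sub>R v i" .
      qed simp
      finally show ?thesis .
    qed
    moreover have "(q - 1) *\<^sub>R (\<Sum>j<m. q ^ j *\<^sub>R p (d j)) = (\<Sum>j<m. ((q - 1) * q ^ j) *\<^sub>R p (d j))"
      by (simp add: scaleR_sum_right)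
    ultimately have "q ^ m *\<^sub>R x - (q - 1) *\<^sub>R (\<Sum>j<m. q ^ j *\<^sub>R p (d j)) - y
        = h + (\<Sum>i=1..n. ((q - 1) * q ^ i * (\<tau> + R / 2)) *\<^sub>R v i)
          - (\<Sum>i=1..n. ((q - 1) * q ^ i * (\<Sum>k\<in>E i. Q ^ k)) *\<^sub>R v i)"
      unfolding h_def Wx zs_def by (simp add: algebra_simps)
    also have "\<dots> = (\<Sum>i=1..n. g h i *\<^sub>R v i) + (\<Sum>i=1..n. ((q - 1) * q ^ i * (\<tau> + R / 2)) *\<^sub>R v i)
          - (\<Sum>i=1..n. ((q - 1) * q ^ i * (\<Sum>k\<in>E i. Q ^ k)) *\<^sub>R v i)"
      using g(1)[of h] by simp
    also have "\<dots> = (\<Sum>i=1..n. ((q - 1) * q ^ i * (\<tau> + t i - (\<Sum>k\<in>E i. Q ^ k))) *\<^sub>R v i)"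
    proof -
      have "(q - 1) * q ^ i * (\<tau> + t i - s) = g h i + (q - 1) * q ^ i * (\<tau> + R / 2) - (q - 1) * q ^ i * s" for i s
      proof -
        have "(q - 1) * q ^ i * (\<tau> + t i - s) = (q - 1) * q ^ i * (g h i / ((q - 1) * q ^ i))
            + (q - 1) * q ^ i * (\<tau> + R / 2) - (q - 1) * q ^ i * s"
          unfolding t_def by (simp only: algebra_simps)
        then show ?thesis using q by simp
      qed
      then show ?thesis
        unfolding sum.distrib[symmetric] sum_subtractf[symmetric]
        by (intro sum.cong) (simp_all only: scaleR_add_left scaleR_diff_left)
    qed
    also have "norm \<dots> \<le> (\<Sum>i=1..n. (q - 1) * q ^ i * \<epsilon> * norm (v i))"
    proof (rule sum_norm_le)
      fix i
      have "norm (((q - 1) * q ^ i * (\<tau> + t i - (\<Sum>k\<in>E i. Q ^ k))) *\<^sub>R v i)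
          = (q - 1) * q ^ i * \<bar>\<tau> + t i - (\<Sum>k\<in>E i. Q ^ k)\<bar> * norm (v i)"
        using q by (simp add: abs_mult)
      also have "\<dots> \<le> (q - 1) * q ^ i * \<epsilon> * norm (v i)"
        using q E(2)[of i] by (intro mult_right_mono mult_left_mono) auto
      finally show "norm (((q - 1) * q ^ i * (\<tau> + t i - (\<Sum>k\<in>E i. Q ^ k))) *\<^sub>R v i) \<le> (q - 1) * q ^ i * \<epsilon> * norm (v i)" .
    qed
    also have "\<dots> = \<epsilon> * V" unfolding V_def sum_distrib_left by (simp add: mult_ac)
    also have "\<dots> < e" by (rule \<epsilon>V)
    finally show "dist (q ^ m *\<^sub>R x - (q - 1) *\<^sub>R (\<Sum>j<m. q ^ j *\<^sub>R p (d j))) y < e"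
      by (simp add: dist_norm)
  qed
qed

section \<open>The attractor and universal codings\<close>

lemma word_map_eq_foldr: "word_map lam p a j z = foldr (hmap lam p) (map a [0..<j]) z"
  by (induction j arbitrary: z) simp_all

lemma foldr_hmap_diff:
  "foldr (hmap lam p) v x - foldr (hmap lam p) v y = lam ^ length v *\<^sub>R (x - y)"
proof (induction v)
  case (Cons i v)
  have "foldr (hmap lam p) (i # v) x - foldr (hmap lam p) (i # v) y
      = lam *\<^sub>R (foldr (hmap lam p) v x - foldr (hmap lam p) v y)"
    by (simp add: hmap_def algebra_simps)
  then show ?case unfolding Cons by simp
qed simp

lemma foldr_hmap_mem:
  assumes "\<And>i z. i \<le> n \<Longrightarrow> z \<in> X \<Longrightarrow> hmap lam p i z \<in> X" "set v \<subseteq> {..n}" "z \<in> X"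
  shows "foldr (hmap lam p) v z \<in> X"
  using assms(2) by (induction v) (use assms(1,3) in auto)

text \<open>The digit with the highest power of \<open>q\<close> is expanded first and is undone
  last, so it is outermost in the composition; hence the reversed list.\<close>

lemma foldr_hmap_expand:
  assumes "lam \<noteq> 0" "q = 1 / lam"
  shows "foldr (hmap lam p) (map d (rev [0..<m])) (q ^ m *\<^sub>R x - (q - 1) *\<^sub>R (\<Sum>j<m. q ^ j *\<^sub>R p (d j))) = x"
proof (induction m arbitrary: x)
  case (Suc m)
  define x1 where "x1 = q *\<^sub>R x - (q - 1) *\<^sub>R p (d m)"
  have "q ^ Suc m *\<^sub>R x - (q - 1) *\<^sub>R (\<Sum>j<Suc m. q ^ j *\<^sub>R p (d j))
      = q ^ m *\<^sub>R x1 - (q - 1) *\<^sub>R (\<Sum>j<m. q ^ j *\<^sub>R p (d j))"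
    by (simp add: x1_def algebra_simps)
  moreover have "hmap lam p (d m) x1 = x"
  proof -
    have "lam * q = 1" "lam * (q - 1) = 1 - lam" using assms by (simp_all add: algebra_simps)
    then show ?thesis by (simp add: hmap_def x1_def scaleR_diff_right)
  qed
  ultimately show ?case using Suc[of x1] by (simp del: sum.lessThan_Suc power_Suc)
qed simp

text \<open>Each point of \<open>X\<close> is the image of a point of \<open>X\<close> under words
  of every length. Starting the same word from a point of \<open>Y\<close> moves the result by at
  most \<open>lam ^ j * B\<close>, and \<open>Y\<close> is closed.\<close>

lemma invariant_compact_subset:
  fixes p :: "nat \<Rightarrow> 'a::euclidean_space"
  assumes lam: "0 < lam" "lam < 1"
    and X: "bounded X" "X \<subseteq> (\<Union>i\<in>{..n}. hmap lam p i ` X)"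
    and Y: "Y \<noteq> {}" "compact Y" "(\<Union>i\<in>{..n}. hmap lam p i ` Y) \<subseteq> Y"
  shows "X \<subseteq> Y"
proof
  fix x assume x: "x \<in> X"
  have ex: "\<exists>v z. length v = j \<and> set v \<subseteq> {..n} \<and> z \<in> X \<and> x = foldr (hmap lam p) v z" for j
  proof (induction j)
    case 0
    then show ?case using x by (intro exI[of _ "[]"]) auto
  next
    case (Suc j)
    then obtain v z where v: "length v = j" "set v \<subseteq> {..n}" "z \<in> X" "x = foldr (hmap lam p) v z" by blast
    obtain i z' where "i \<le> n" "z' \<in> X" "z = hmap lam p i z'" using X(2) v(3) by auto
    then show ?case using v by (intro exI[of _ "v @ [i]"] exI[of _ z']) auto
  qed
  obtain y where y: "y \<in> Y" using Y by blast
  obtain B where B: "\<And>z. z \<in> X \<Longrightarrow> dist z y \<le> B"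
    using X(1) bounded_any_center[of X y] by (auto simp: dist_commute)
  have near: "\<exists>y'\<in>Y. dist x y' \<le> lam ^ j * B" for j
  proof -
    obtain v z where v: "length v = j" "set v \<subseteq> {..n}" "z \<in> X" "x = foldr (hmap lam p) v z" using ex by blast
    have mem: "foldr (hmap lam p) v y \<in> Y" using Y(3) v(2) y by (intro foldr_hmap_mem[of n]) auto
    have "dist x (foldr (hmap lam p) v y) = lam ^ j * dist z y"
      unfolding v(4) dist_norm foldr_hmap_diff using lam v(1) by simp
    also have "\<dots> \<le> lam ^ j * B" using lam B[OF v(3)] by (intro mult_left_mono) auto
    finally show ?thesis using mem by blast
  qed
  have "x \<in> closure Y"
    unfolding closure_approachable
  proof (intro allI impI)
    fix e :: real assume e: "0 < e"
    have "(\<lambda>j. lam ^ j * B) \<longlonglongrightarrow> 0 * B"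
      using lam by (intro tendsto_mult LIMSEQ_realpow_zero tendsto_const) auto
    then have "\<forall>\<^sub>F j in sequentially. lam ^ j * B < e" using e by (intro order_tendstoD) auto
    from eventually_happens'[OF sequentially_bot this] obtain j where j: "lam ^ j * B < e" ..
    obtain y' where "y' \<in> Y" "dist x y' \<le> lam ^ j * B" using near by blast
    then show "\<exists>y\<in>Y. dist y x < e" using j by (intro bexI[of _ y']) (auto simp: dist_commute)
  qed
  then show "x \<in> Y" using compact_imp_closed[OF Y(2)] by simp
qed

text \<open>\<open>convex_hull_image_step\<close> with \<open>w = 1 - lam\<close> shows that the
  images of the hull cover it. Uniqueness, required by the definite description, comes from
  \<open>invariant_compact_subset\<close> in both directions.\<close>

lemma attractor_eq_convex_hull:
  fixes p :: "nat \<Rightarrow> 'a::euclidean_space"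
  assumes n: "1 \<le> n" and lam: "0 < lam" "lam < 1" "real (n + 1) * (1 - lam) \<le> 1"
  shows "attractor lam p n = convex hull (p ` {..n})"
    and "\<And>i z. i \<le> n \<Longrightarrow> z \<in> convex hull (p ` {..n}) \<Longrightarrow> hmap lam p i z \<in> convex hull (p ` {..n})"
proof -
  let ?H = "convex hull (p ` {..n})"
  show mem: "hmap lam p i z \<in> ?H" if "i \<le> n" "z \<in> ?H" for i z
    unfolding hmap_def using that lam
    by (intro convexD[OF convex_convex_hull]) (auto intro: hull_inc)
  have sub: "?H \<subseteq> (\<Union>i\<in>{..n}. hmap lam p i ` ?H)"
  proof
    fix x assume "x \<in> ?H"
    then obtain i x' where "i \<le> n" "x' \<in> ?H" "1 *\<^sub>R x = (1 - lam) *\<^sub>R p i + (1 - (1 - lam)) *\<^sub>R x'"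
      using convex_hull_image_step[of x p n "1 - lam" 1] n lam by auto
    then show "x \<in> (\<Union>i\<in>{..n}. hmap lam p i ` ?H)"
      by (intro UN_I[of i] image_eqI[of _ _ x']) (auto simp: hmap_def)
  qed
  have sup: "(\<Union>i\<in>{..n}. hmap lam p i ` ?H) \<subseteq> ?H" using mem by blast
  have H: "?H \<noteq> {}" "compact ?H" by (simp_all add: finite_imp_compact_convex_hull)
  show "attractor lam p n = ?H"
    unfolding attractor_def
  proof (rule the_equality)
    show "?H \<noteq> {} \<and> compact ?H \<and> ?H = (\<Union>i\<in>{..n}. hmap lam p i ` ?H)"
      using H equalityI[OF sub sup] by (intro conjI)
    fix X assume X: "X \<noteq> {} \<and> compact X \<and> X = (\<Union>i\<in>{..n}. hmap lam p i ` X)"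
    then have X': "X \<noteq> {}" "compact X" "X \<subseteq> (\<Union>i\<in>{..n}. hmap lam p i ` X)"
      "(\<Union>i\<in>{..n}. hmap lam p i ` X) \<subseteq> X"
      by (blast, blast, metis equalityD1, metis equalityD2)
    show "X = ?H"
      using invariant_compact_subset[OF lam(1,2) compact_imp_bounded[OF X'(2)] X'(3) H sup]
        invariant_compact_subset[OF lam(1,2) compact_imp_bounded[OF H(2)] sub X'(1,2,4)]
      by (rule equalityI)
  qed
qed

text \<open>All words are enumerated and appended one after another, each through an extension that
  stays in \<open>P\<close>. The last conclusion keeps the link between the limit sequence and
  \<open>P\<close>.\<close>

lemma universal_sequence_from_extensions:
  assumes nil: "P []" and digits: "\<And>v. P v \<Longrightarrow> set v \<subseteq> {..n}"
    and ext: "\<And>v w. P v \<Longrightarrow> set w \<subseteq> {..n} \<Longrightarrow> \<exists>u. P (v @ u @ w)"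
  obtains a where "\<And>k. a k \<le> n" "universal n a"
    "\<And>j. \<exists>v. P v \<and> j \<le> length v \<and> take j v = map a [0..<j]"
proof -
  \<comment> \<open>Words with a digit above \<open>n\<close> are replaced by the empty word. The
    trailing 0 makes every stage strictly longer, so that \<open>V k\<close> has length at least
    \<open>k\<close>.\<close>
  define wd :: "nat \<Rightarrow> nat list" where
    "wd k = (if set (from_nat k :: nat list) \<subseteq> {..n} then from_nat k else []) @ [0]" for k
  define nxt where "nxt k v = (SOME v'. P v' \<and> (\<exists>u. v' = v @ u @ wd k))" for k v
  define V where "V = rec_nat [] nxt"
  have V0: "V 0 = []" and VS: "V (Suc k) = nxt k (V k)" for k by (simp_all add: V_def)
  have nxt: "P (nxt k v) \<and> (\<exists>u. nxt k v = v @ u @ wd k)" if Pv: "P v" for k v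
  proof -
    have "set (wd k) \<subseteq> {..n}" by (auto simp: wd_def)
    then obtain u where "P (v @ u @ wd k)" using ext[OF Pv] by blast
    then have "\<exists>v'. P v' \<and> (\<exists>u. v' = v @ u @ wd k)" by blast
    then show ?thesis unfolding nxt_def by (rule someI_ex)
  qed
  have PV: "P (V k)" for k by (induction k) (use nil nxt in \<open>auto simp: V0 VS\<close>)
  have step: "\<exists>u. V (Suc k) = V k @ u @ wd k" for k using nxt[OF PV] by (simp add: VS)
  have len: "k \<le> length (V k)" for k
  proof (induction k)
    case (Suc k)
    then show ?case using step[of k] by (auto simp: wd_def)
  qed simp
  have prefix: "\<exists>s. V j = V i @ s" if "i \<le> j" for i j
    using that
  proof (induction rule: dec_induct)
    case (step k)
    then show ?case using \<open>\<And>k. \<exists>u. V (Suc k) = V k @ u @ wd k\<close>[of k] by auto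
  qed simp
  define a where "a i = V (Suc i) ! i" for i
  have Va: "V k ! i = a i" if "i < length (V k)" for i k
  proof (cases "k \<le> Suc i")
    case True
    then show ?thesis using prefix[OF True] that by (auto simp: a_def nth_append)
  next
    case False
    then have le: "Suc i \<le> k" by simp
    show ?thesis using prefix[OF le] len[of "Suc i"] by (auto simp: a_def nth_append)
  qed
  show ?thesis
  proof (rule that)
    show "a k \<le> n" for k
    proof -
      have "k < length (V (Suc k))" using len[of "Suc k"] by simp
      then have "a k \<in> set (V (Suc k))" by (simp add: a_def)
      then show ?thesis using digits[OF PV[of "Suc k"]] by auto
    qed
    show "\<exists>v. P v \<and> j \<le> length v \<and> take j v = map a [0..<j]" for j
    proof (intro exI conjI)
      show "P (V j)" "j \<le> length (V j)" by (rule PV, rule len)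
      show "take j (V j) = map a [0..<j]"
        using len[of j] by (intro nth_equalityI) (auto simp: Va)
    qed
    show "universal n a"
      unfolding universal_def
    proof (intro allI impI)
      fix w :: "nat list" assume w: "set w \<subseteq> {..n}"
      define k where "k = to_nat w"
      obtain u where u: "V (Suc k) = V k @ u @ w @ [0]" using step[of k] w by (auto simp: wd_def k_def)
      show "\<exists>k. \<forall>i<length w. a (k + i) = w ! i"
      proof (intro exI allI impI)
        fix i assume i: "i < length w"
        have "V (Suc k) ! (length (V k @ u) + i) = w ! i" using i by (simp add: u nth_append)
        moreover have "length (V k @ u) + i < length (V (Suc k))" using i by (simp add: u)
        ultimately show "a (length (V k @ u) + i) = w ! i" using Va by simp
      qed
    qed
  qed
qed

text \<open>\<open>coding\<close> is a \<open>lim\<close>, so it is informative only once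
  convergence is known; domination by a geometric series supplies it.\<close>

lemma word_map_tendsto_coding:
  fixes p :: "nat \<Rightarrow> 'a::euclidean_space"
  assumes lam: "0 < lam" "lam < 1" and a: "\<And>k. a k \<le> n"
  shows "word_map lam p a j 0 = (\<Sum>k<j. (lam ^ k * (1 - lam)) *\<^sub>R p (a k))"
    and "(\<lambda>j. word_map lam p a j 0) \<longlonglongrightarrow> coding lam p a"
proof -
  have eq: "word_map lam p a j 0 = (\<Sum>k<j. (lam ^ k * (1 - lam)) *\<^sub>R p (a k))" for j
  proof (induction j)
    case (Suc j)
    have "word_map lam p a (Suc j) 0 - word_map lam p a j 0 = lam ^ j *\<^sub>R (hmap lam p (a j) 0)"
      using foldr_hmap_diff[of lam p "map a [0..<j]" "hmap lam p (a j) 0" 0]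
      by (simp add: word_map_eq_foldr)
    then show ?case using Suc by (simp add: hmap_def algebra_simps del: word_map.simps)
  qed simp
  then show "word_map lam p a j 0 = (\<Sum>k<j. (lam ^ k * (1 - lam)) *\<^sub>R p (a k))" .
  define B where "B = (\<Sum>i\<le>n. norm (p i))"
  have B: "norm (p (a k)) \<le> B" for k
    unfolding B_def using a[of k] by (intro member_le_sum[of "a k" "{..n}" "\<lambda>i. norm (p i)"]) auto
  have "summable (\<lambda>k. (lam ^ k * (1 - lam)) *\<^sub>R p (a k))"
  proof (rule summable_comparison_test')
    show "summable (\<lambda>k. lam ^ k * ((1 - lam) * B))"
      using lam by (intro summable_mult2 summable_geometric) auto
    show "norm ((lam ^ k * (1 - lam)) *\<^sub>R p (a k)) \<le> lam ^ k * ((1 - lam) * B)" for k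
      using lam B[of k] by (simp add: abs_mult mult.assoc)
  qed
  then have "convergent (\<lambda>j. word_map lam p a j 0)"
    unfolding eq summable_iff_convergent .
  then show "(\<lambda>j. word_map lam p a j 0) \<longlonglongrightarrow> coding lam p a"
    unfolding coding_def by (simp add: convergent_LIMSEQ_iff)
qed

section \<open>Universal codings and the interior of the hull\<close>

lemma universal_coding_in_interior:
  fixes p :: "nat \<Rightarrow> 'a::euclidean_space"
  assumes full: "aff_dim (p ` {..n}) = int DIM('a)" and lam: "0 < lam" "lam < 1"
    and a: "\<And>k. a k \<le> n" "universal n a" and x: "coding lam p a = x" "x \<in> convex hull (p ` {..n})"
  shows "x \<in> interior (convex hull (p ` {..n}))"
proof (rule ccontr)
  let ?H = "convex hull (p ` {..n})"
  assume nint: "x \<notin> interior ?H"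
  have ri: "rel_interior ?H = interior ?H" using full by (intro rel_interior_interior) (simp add: aff_dim_eq_full)
  have nri: "x \<notin> rel_interior ?H" using nint ri by simp
  obtain f where "f \<noteq> 0" and f: "\<And>y. y \<in> ?H \<Longrightarrow> f \<bullet> x \<le> f \<bullet> y"
      "\<And>y. y \<in> rel_interior ?H \<Longrightarrow> f \<bullet> x < f \<bullet> y"
    by (rule supporting_hyperplane_rel_boundary[OF convex_convex_hull x(2) nri]) (rule that, assumption, auto)
  define c where "c = f \<bullet> x"
  have "rel_interior ?H \<noteq> {}" by (simp add: rel_interior_eq_empty)
  then obtain y where y: "y \<in> rel_interior ?H" by blast
  \<comment> \<open>Not all \<open>p i\<close> lie on the supporting hyperplane, since a point of
    the relative interior is strictly above it.\<close>
  have "\<exists>i\<le>n. c < f \<bullet> p i"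
  proof (rule ccontr)
    assume "\<not> ?thesis"
    then have "p ` {..n} \<subseteq> {z. f \<bullet> z \<le> c}" by auto
    then have "?H \<subseteq> {z. f \<bullet> z \<le> c}" by (intro hull_minimal convex_halfspace_le)
    then have "f \<bullet> y \<le> c" using y rel_interior_subset by blast
    then show False using f(2)[OF y] by (simp add: c_def)
  qed
  then obtain i where i: "i \<le> n" "c < f \<bullet> p i" by blast
  obtain k where "\<forall>l<length [i]. a (k + l) = [i] ! l"
    using a(2) i(1) unfolding universal_def by (metis empty_set list.simps(15) atMost_iff insert_subset empty_subsetI)
  then have k: "a k = i" by auto
  \<comment> \<open>The surplus contributed by the digit \<open>i\<close> at position
    \<open>k\<close>. All other digits contribute at least their share of \<open>c\<close>, so the
    surplus survives in the limit.\<close>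
  define g where "g = lam ^ k * (1 - lam) * (f \<bullet> p i - c)"
  have g0: "0 < g" using lam i by (simp add: g_def)
  have geo: "(\<Sum>l<j. lam ^ l * (1 - lam)) = 1 - lam ^ j" for j
    by (induction j) (simp_all add: algebra_simps)
  have lower: "(1 - lam ^ j) * c + g \<le> f \<bullet> word_map lam p a j 0" if "k < j" for j
  proof -
    have "(1 - lam ^ j) * c + g = (\<Sum>l<j. lam ^ l * (1 - lam) * c + (if l = k then g else 0))"
      using that geo[of j] by (simp add: sum.distrib flip: sum_distrib_right)
    also have "\<dots> \<le> (\<Sum>l<j. lam ^ l * (1 - lam) * (f \<bullet> p (a l)))"
    proof (rule sum_mono)
      fix l
      have "c \<le> f \<bullet> p (a l)" unfolding c_def using a(1)[of l] by (intro f(1) hull_inc) auto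
      then show "lam ^ l * (1 - lam) * c + (if l = k then g else 0) \<le> lam ^ l * (1 - lam) * (f \<bullet> p (a l))"
        using lam k by (cases "l = k") (simp_all add: g_def right_diff_distrib)
    qed
    finally show ?thesis
      unfolding word_map_tendsto_coding(1)[where n=n, OF lam a(1)] by (simp add: inner_sum_right)
  qed
  have "c + g \<le> c"
  proof (rule tendsto_le[OF sequentially_bot])
    show "(\<lambda>j. f \<bullet> word_map lam p a j 0) \<longlonglongrightarrow> c"
      unfolding c_def x(1)[symmetric] by (intro tendsto_intros word_map_tendsto_coding(2)[where n=n, OF lam a(1)])
    have "(\<lambda>j. (1 - lam ^ j) * c + g) \<longlonglongrightarrow> (1 - 0) * c + g"
      using lam by (intro tendsto_intros LIMSEQ_realpow_zero) auto
    then show "(\<lambda>j. (1 - lam ^ j) * c + g) \<longlonglongrightarrow> c + g" by simp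
    show "\<forall>\<^sub>F j in sequentially. (1 - lam ^ j) * c + g \<le> f \<bullet> word_map lam p a j 0"
      using eventually_gt_at_top[of k] by eventually_elim (rule lower)
  qed
  then show False using g0 by simp
qed

text \<open>The invariant \<open>P v\<close> says that \<open>x\<close> is the image under
  \<open>v\<close> of an interior point. Density of the expanding orbit from that point allows any
  word \<open>w\<close> to be appended after a connecting word \<open>u\<close>.\<close>

lemma interior_point_has_universal_coding:
  fixes p :: "nat \<Rightarrow> 'a::euclidean_space"
  assumes inj: "inj_on p {..n}" and full: "aff_dim (p ` {..n}) = int DIM('a)"
    and lam: "0 < lam" "lam < 1" and q: "q = 1 / lam"
      "q ^ (n + 1) < 1 + 1/100" "real (n + 1) * (q ^ (n + 1) - 1) \<le> 1/2"
    and mem: "\<And>i z. i \<le> n \<Longrightarrow> z \<in> convex hull (p ` {..n}) \<Longrightarrow> hmap lam p i z \<in> convex hull (p ` {..n})"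
    and x: "x \<in> interior (convex hull (p ` {..n}))"
  obtains a where "\<And>k. a k \<le> n" "universal n a" "coding lam p a = x"
proof -
  let ?H = "convex hull (p ` {..n})" and ?S = "foldr (hmap lam p)"
  have q1: "1 < q" using lam q(1) by simp
  define P where "P v \<longleftrightarrow> set v \<subseteq> {..n} \<and> (\<exists>z\<in>interior ?H. x = ?S v z)" for v
  have ext: "\<exists>u. P (v @ u @ w)" if v: "P v" and w: "set w \<subseteq> {..n}" for v w
  proof -
    obtain z where z: "z \<in> interior ?H" "x = ?S v z" using v by (auto simp: P_def)
    obtain r where r: "0 < r" "ball z r \<subseteq> interior ?H" using z(1) open_interior open_contains_ball by blast
    \<comment> \<open>The orbit is steered to \<open>y\<close>, the image of \<open>z\<close> under
      \<open>w\<close>. With tolerance \<open>lam ^ length w * r\<close>, undoing \<open>w\<close>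
      lands within \<open>r\<close> of \<open>z\<close>, hence again in the interior.\<close>
    define y where "y = ?S w z"
    have e: "0 < lam ^ length w * r" using lam r by simp
    obtain m d where d: "\<And>j. d j \<le> n"
      "dist (q ^ m *\<^sub>R z - (q - 1) *\<^sub>R (\<Sum>j<m. q ^ j *\<^sub>R p (d j))) y < lam ^ length w * r"
      using expanding_orbit_dense[OF inj full q1 q(2,3) z(1) e] by blast
    define y' where "y' = q ^ m *\<^sub>R z - (q - 1) *\<^sub>R (\<Sum>j<m. q ^ j *\<^sub>R p (d j))"
    define u where "u = map d (rev [0..<m])"
    have zu: "z = ?S u y'" unfolding u_def y'_def using lam q(1) by (intro foldr_hmap_expand[symmetric]) auto
    define z' where "z' = z + (1 / lam ^ length w) *\<^sub>R (y' - y)"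
    have "dist z z' = dist y' y / lam ^ length w"
      using lam by (simp add: z'_def dist_norm)
    also have "\<dots> < r" using d(2) lam by (simp add: y'_def divide_less_eq mult.commute)
    finally have z': "z' \<in> interior ?H" using r(2) by auto
    have "?S w z' - ?S w z = y' - y" unfolding foldr_hmap_diff using lam by (simp add: z'_def)
    then have "?S w z' = y'" by (simp add: y_def)
    then have "x = ?S (v @ u @ w) z'" using z(2) zu by simp
    moreover have "set u \<subseteq> {..n}" using d(1) by (auto simp: u_def)
    ultimately have "P (v @ u @ w)" using z' v w unfolding P_def by auto
    then show ?thesis by blast
  qed
  obtain a where a: "\<And>k. a k \<le> n" "universal n a"
    "\<And>j. \<exists>v. P v \<and> j \<le> length v \<and> take j v = map a [0..<j]"
    using universal_sequence_from_extensions[of P n] ext x by (auto simp: P_def)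
  have "bounded ?H" by (simp add: compact_imp_bounded finite_imp_compact_convex_hull)
  then obtain B where B: "\<And>z. z \<in> ?H \<Longrightarrow> norm z \<le> B" by (auto simp: bounded_iff)
  \<comment> \<open>Both points are images under the first \<open>j\<close> digits of
    \<open>a\<close>, one of 0 and the other of a point of the hull.\<close>
  have "norm (word_map lam p a j 0 - x) \<le> lam ^ j * B" for j
  proof -
    obtain v z where v: "set v \<subseteq> {..n}" "z \<in> interior ?H" "x = ?S v z" "take j v = map a [0..<j]"
      using a(3)[of j] by (auto simp: P_def)
    have "?S (drop j v) z \<in> ?H"
      using v(1) mem set_drop_subset[of j v] interior_subset[THEN subsetD, OF v(2)]
      by (intro foldr_hmap_mem[of n]) auto
    moreover have "x = ?S (map a [0..<j]) (?S (drop j v) z)"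
      unfolding v(3) v(4)[symmetric] by (metis append_take_drop_id comp_apply foldr_append)
    then have "word_map lam p a j 0 - x = lam ^ j *\<^sub>R (0 - ?S (drop j v) z)"
      using foldr_hmap_diff[of lam p "map a [0..<j]" 0 "?S (drop j v) z"] by (simp add: word_map_eq_foldr)
    ultimately show ?thesis using lam B by (simp add: mult_left_mono)
  qed
  then have est: "\<forall>\<^sub>F j in sequentially. norm (word_map lam p a j 0 - x) \<le> lam ^ j * B" by simp
  have "(\<lambda>j. lam ^ j * B) \<longlonglongrightarrow> 0"
    using lam by (intro tendsto_mult_left_zero LIMSEQ_realpow_zero) auto
  with est have "(\<lambda>j. word_map lam p a j 0 - x) \<longlonglongrightarrow> 0" by (rule Lim_null_comparison)
  then have "(\<lambda>j. word_map lam p a j 0) \<longlonglongrightarrow> x" by (simp add: LIM_zero_iff)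
  then have "coding lam p a = x" unfolding coding_def by (rule limI)
  with a show ?thesis by (intro that)
qed

theorem theorem1p2:
  fixes p :: "nat \<Rightarrow> 'a::euclidean_space" and n :: nat
  assumes "inj_on p {..n}"
    and "aff_dim (p ` {..n}) = int DIM('a)"
  shows "\<exists>\<delta>>0. \<forall>lam. 1 - \<delta> < lam \<and> lam < 1 \<longrightarrow>
           X_uni lam p n = interior (attractor lam p n)"
proof -
  have n1: "1 \<le> n"
  proof (rule ccontr)
    assume "\<not> 1 \<le> n"
    then have "n = 0" by simp
    then have "int DIM('a) = 0" using assms(2) by simp
    then show False using DIM_positive[where 'a='a] by simp
  qed
  \<comment> \<open>The first entry serves the arithmetic of bases below 1.01, applied to
    \<open>q ^ (n + 1)\<close>; the second gives the greedy condition on the weights.\<close>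
  define \<epsilon> where "\<epsilon> = min (1/100) (1 / (2 * real (n + 1)))"
  have \<epsilon>: "0 < \<epsilon>" by (simp add: \<epsilon>_def)
  have "((\<lambda>l::real. (1 / l) ^ (n + 1)) \<longlongrightarrow> (1 / 1) ^ (n + 1)) (at 1)"
    by (intro tendsto_intros) auto
  then have "\<forall>\<^sub>F l in at (1::real). (1 / l) ^ (n + 1) < 1 + \<epsilon>"
    using \<epsilon> by (intro order_tendstoD) auto
  then obtain s where s: "0 < s" "\<And>l::real. l \<noteq> 1 \<Longrightarrow> dist l 1 < s \<Longrightarrow> (1 / l) ^ (n + 1) < 1 + \<epsilon>"
    by (auto simp: eventually_at)
  \<comment> \<open>The entry \<open>s\<close> controls \<open>(1 / lam) ^ (n + 1)\<close>; the
    other makes \<open>lam\<close> positive and lets the images of the hull cover it.\<close>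
  define \<delta> where "\<delta> = min s (1 / real (n + 1))"
  show ?thesis
  proof (intro exI[of _ \<delta>] conjI allI impI)
    show "0 < \<delta>" using s(1) by (simp add: \<delta>_def)
    fix lam :: real assume l: "1 - \<delta> < lam \<and> lam < 1"
    have "\<delta> \<le> 1 / real (n + 1)" unfolding \<delta>_def by (rule min.cobounded2)
    then have "1 - lam < 1 / real (n + 1)" using l by linarith
    then have l1: "real (n + 1) * (1 - lam) \<le> 1" by (simp add: field_simps)
    have "1 / real (n + 1) \<le> 1" by simp
    then have l0: "0 < lam" using \<open>1 - lam < 1 / real (n + 1)\<close> by linarith
    have "(1 / lam) ^ (n + 1) < 1 + \<epsilon>" using l by (intro s(2)) (auto simp: dist_real_def \<delta>_def)
    then have q1: "(1 / lam) ^ (n + 1) < 1 + 1/100" and "(1 / lam) ^ (n + 1) - 1 \<le> 1 / (2 * real (n + 1))"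
      unfolding \<epsilon>_def by linarith+
    then have q2: "real (n + 1) * ((1 / lam) ^ (n + 1) - 1) \<le> 1/2"
      by (simp only: pos_le_divide_eq) (simp add: field_simps)
    note H = attractor_eq_convex_hull[OF n1 l0 _ l1]
    let ?H = "convex hull (p ` {..n})"
    have att: "attractor lam p n = ?H" using H(1) l by simp
    have mem: "hmap lam p i z \<in> ?H" if "i \<le> n" "z \<in> ?H" for i z using H(2) l that by blast
    show "X_uni lam p n = interior (attractor lam p n)"
      unfolding att
    proof
      show "X_uni lam p n \<subseteq> interior ?H"
        unfolding X_uni_def att using universal_coding_in_interior[OF assms(2) l0] l by blast
      show "interior ?H \<subseteq> X_uni lam p n"
      proof
        fix x assume x: "x \<in> interior ?H"
        obtain a where "\<And>k. a k \<le> n" "universal n a" "coding lam p a = x"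
          using interior_point_has_universal_coding[OF assms l0 _ refl q1 q2 mem x] l by blast
        then show "x \<in> X_uni lam p n"
          using x interior_subset[of ?H] unfolding X_uni_def att by blast
      qed
    qed
  qed
qed

end
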